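(* Let $q=2^m$, where $m$ is an odd prime. Then there exists a strongly regular graph (of Latin square type) with parameters $$\left(\tfrac{1}{2}q^2(q-1)^2,\ m(q+1)\left(\tfrac{q(q-1)}{2}-1\right),\ \lambda,\ \mu\right),$$ where $\lambda=\frac{q(q-1)}{2}+m^2(q+1)^2-3m(q+1)$ and $\mu=m^2(q+1)^2-m(q+1)$.
   Context: A strongly regular graph $\mathrm{srg}(v,k,\lambda,\mu)$ is a graph on $v$ vertices, regular of valency $k$, in which any two adjacent vertices have exactly $\lambda$ common neighbours and any two distinct nonadjacent vertices have exactly $\mu$ common neighbours. It is of Latin square type if $(v,k,\lambda,\mu)=(n^2,t(n-1),n+t^2-3t,t^2-t)$ for some integers $n$ and $1\le t\le n+1$.
   Formalization: The printed number of vertices ½q²(q−1)² is corrected to ¼q²(q−1)²; the identity k(k−λ−1)=(v−k−1)μ forces this value (for m=3 it gives 784, not the printed 1568), so no graph with the printed parameters exists. *)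

theory Defs
  imports
    Complex_Main
    "HOL-Computational_Algebra.Primes"
    "Graph_Theory.Pair_Digraph"
begin

text \<open>
  The locale predicate \<^const>\<open>pair_graph\<close> describes the finite simple graphs: the arc set is a
  finite, symmetric and irreflexive relation on the finite vertex set, an edge \<open>{x, y}\<close> being
  represented by the two arcs \<open>(x, y)\<close> and \<open>(y, x)\<close>. Hence the valency of a vertex is its
  out-degree. Parameters are integers, so that subtraction is not truncated.
\<close>

definition common_neighbours :: "'a pair_pre_digraph \<Rightarrow> 'a \<Rightarrow> 'a \<Rightarrow> 'a set" where
  "common_neighbours G x y = {z \<in> pverts G. (x, z) \<in> parcs G \<and> (y, z) \<in> parcs G}"

definition strongly_regular ::
  "'a pair_pre_digraph \<Rightarrow> int \<Rightarrow> int \<Rightarrow> int \<Rightarrow> int \<Rightarrow> bool" where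
  "strongly_regular G v k l \<mu> \<longleftrightarrow>
     pair_graph G \<and>
     int (card (pverts G)) = v \<and>
     (\<forall>x\<in>pverts G. int (out_degree (with_proj G) x) = k) \<and>
     (\<forall>x\<in>pverts G. \<forall>y\<in>pverts G. (x, y) \<in> parcs G \<longrightarrow>
        int (card (common_neighbours G x y)) = l) \<and>
     (\<forall>x\<in>pverts G. \<forall>y\<in>pverts G. x \<noteq> y \<and> (x, y) \<notin> parcs G \<longrightarrow>
        int (card (common_neighbours G x y)) = \<mu>)"

definition latin_square_type :: "int \<Rightarrow> int \<Rightarrow> int \<Rightarrow> int \<Rightarrow> bool" where
  "latin_square_type v k l \<mu> \<longleftrightarrow>
     (\<exists>n t. 1 \<le> t \<and> t \<le> n + 1 \<and>
        (v, k, l, \<mu>) = (n\<^sup>2, t * (n - 1), n + t\<^sup>2 - 3 * t, t\<^sup>2 - t))"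

end

theory Submission
  imports "HOL-Algebra.Algebraic_Closure_Type" "HOL-Library.Z2" Defs
begin

text \<open>
  Let \<open>F\<close> be the field of \<open>q = 2 ^ m\<close> elements and \<open>T = {y\<^sup>2 + y | y \<in> F}\<close>, an additive subgroup
  of index 2 which does not contain 1 since \<open>m\<close> is odd. On the \<open>q (q - 1) / 2\<close> points \<open>(a, c)\<close>
  with \<open>a c \<notin> T\<close> consider the colouring \<open>r x y = [x, y]\<^sup>2 + Q (x + y)\<close>, where \<open>Q (a, c) = a c\<close>
  and \<open>[x, y]\<close> is its polar form. Affine transvections preserve \<open>r\<close> and act transitively on the pairs of
  points of a given colour, so \<open>r\<close> defines an association scheme. All its nontrivial valencies are
  \<open>q + 1\<close>, and two distinct points are in equal relation to exactly \<open>q\<close> points: it is pseudocyclic.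

  Fusing the colours in one orbit of the Frobenius map yields again a pseudocyclic scheme,
  with valencies \<open>m (q + 1)\<close>: a Frobenius power that is not the identity fixes
  only the elements 0 and 1 of \<open>F\<close> as \<open>m\<close> is prime, hence it never preserves the colour
  of two distinct points, because these have their colour in \<open>T - {0}\<close>.

  For a pseudocyclic scheme with colouring \<open>c\<close>, joining \<open>(x, y)\<close> to \<open>(x', y')\<close> when
  \<open>c x x' = c y y'\<close> is a nontrivial colour gives a strongly regular graph of Latin square type.
\<close>

section \<open>Pseudocyclic schemes and Latin square type graphs\<close>

text \<open>Transport along an injection into the naturals. Afterwards only counts for a relation
  \<open>E\<close> on an arbitrary finite set remain, and the vertex type of the graph is
  settled.\<close>

lemma strongly_regular_nat_graphI:
  fixes V :: "'a set" and E :: "'a \<Rightarrow> 'a \<Rightarrow> bool"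
  assumes fin: "finite V"
    and sym: "\<And>x y. x \<in> V \<Longrightarrow> y \<in> V \<Longrightarrow> E x y \<Longrightarrow> E y x"
    and irrefl: "\<And>x. x \<in> V \<Longrightarrow> \<not> E x x"
    and v: "int (card V) = v"
    and k: "\<And>x. x \<in> V \<Longrightarrow> int (card {z \<in> V. E x z}) = k"
    and l: "\<And>x y. x \<in> V \<Longrightarrow> y \<in> V \<Longrightarrow> E x y \<Longrightarrow> int (card {z \<in> V. E x z \<and> E y z}) = l"
    and \<mu>: "\<And>x y. x \<in> V \<Longrightarrow> y \<in> V \<Longrightarrow> x \<noteq> y \<Longrightarrow> \<not> E x y \<Longrightarrow>
      int (card {z \<in> V. E x z \<and> E y z}) = \<mu>"
  shows "\<exists>G :: nat pair_pre_digraph. strongly_regular G v k l \<mu>"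
proof -
  obtain f :: "'a \<Rightarrow> nat" where f: "inj_on f V"
    using finite_imp_inj_to_nat_seg[OF fin] by blast
  define G where "G = \<lparr>pverts = f ` V, parcs = {(f x, f y) | x y. x \<in> V \<and> y \<in> V \<and> E x y}\<rparr>"
  have arc: "(f x, f y) \<in> parcs G \<longleftrightarrow> E x y" if "x \<in> V" "y \<in> V" for x y
    using f that by (auto simp: G_def dest: inj_onD)
  have verts: "pverts G = f ` V"
    by (simp add: G_def)
  have "pair_graph G"
  proof
    show "finite (pverts G)" using fin by (simp add: G_def)
    have "parcs G \<subseteq> pverts G \<times> pverts G" by (auto simp: G_def)
    then show "finite (parcs G)" by (rule finite_subset) (simp add: fin G_def)
    show "fst e \<in> pverts G" "snd e \<in> pverts G" if "e \<in> parcs G" for e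
      using that by (auto simp: G_def)
    show "fst e \<noteq> snd e" if "e \<in> parcs G" for e
    proof -
      from that obtain x y where "e = (f x, f y)" "x \<in> V" "y \<in> V" "E x y"
        by (auto simp: G_def)
      then show ?thesis
        using irrefl inj_onD[OF f, of x y] by auto
    qed
    show "symmetric (with_proj G)"
      using sym by (auto simp: G_def symmetric_def intro!: symI)
  qed
  moreover have "int (card (pverts G)) = v"
    using v f by (simp add: verts card_image)
  moreover have "int (out_degree (with_proj G) (f x)) = k" if x: "x \<in> V" for x
  proof -
    have "out_arcs (with_proj G) (f x) = (\<lambda>z. (f x, f z)) ` {z \<in> V. E x z}"
      using x inj_on_eq_iff[OF f] by (auto simp: out_arcs_def G_def)
    moreover have "inj_on (\<lambda>z. (f x, f z)) {z \<in> V. E x z}"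
      using f by (auto simp: inj_on_def)
    ultimately show ?thesis
      using k[OF x] by (simp add: out_degree_def card_image)
  qed
  moreover have "card (common_neighbours G (f x) (f y)) = card {z \<in> V. E x z \<and> E y z}"
    if "x \<in> V" "y \<in> V" for x y
  proof -
    have "common_neighbours G (f x) (f y) = f ` {z \<in> V. E x z \<and> E y z}"
      using that arc by (auto simp: common_neighbours_def verts)
    moreover have "inj_on f {z \<in> V. E x z \<and> E y z}"
      using f by (rule inj_on_subset) auto
    ultimately show ?thesis by (simp add: card_image)
  qed
  ultimately have "strongly_regular G v k l \<mu>"
    unfolding strongly_regular_def using arc l \<mu> by (auto simp: verts inj_on_eq_iff[OF f])
  then show ?thesis ..
qed

lemma int_card_Diff_singleton:
  assumes "finite A" "x \<in> A"
  shows "int (card (A - {x})) = int (card A) - 1"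
  using card_Suc_Diff1[OF assms] by linarith

text \<open>Double counting: both sums count the same pairs, and the applications below compare
  them.\<close>

lemma card_pairs:
  assumes "finite A" "finite B"
  shows "card {(a, b). a \<in> A \<and> b \<in> B \<and> P a b} = (\<Sum>a\<in>A. card {b \<in> B. P a b})"
    and "card {(a, b). a \<in> A \<and> b \<in> B \<and> P a b} = (\<Sum>b\<in>B. card {a \<in> A. P a b})"
proof -
  have "{(a, b). a \<in> A \<and> b \<in> B \<and> P a b} = (SIGMA a:A. {b \<in> B. P a b})"
    by auto
  then show "card {(a, b). a \<in> A \<and> b \<in> B \<and> P a b} = (\<Sum>a\<in>A. card {b \<in> B. P a b})"
    using assms by simp
  have "{(a, b). a \<in> A \<and> b \<in> B \<and> P a b} = (SIGMA b:B. {a \<in> A. P a b})\<inverse>"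
    by auto
  then show "card {(a, b). a \<in> A \<and> b \<in> B \<and> P a b} = (\<Sum>b\<in>B. card {a \<in> A. P a b})"
    using assms by (simp add: card_inverse)
qed

text \<open>A symmetric association scheme: \<open>coherent\<close> says that intersection numbers
  depend only on the colour of the pair, \<open>valency\<close> that each nontrivial colour occurs
  \<open>t\<close> times at each point. \<open>equal_colours\<close> is pseudocyclicity: for a fixed
  nontrivial colour, the intersection numbers with \<open>i = j\<close> add up to
  \<open>t - 1\<close>.\<close>

locale pseudocyclic =
  fixes \<Omega> :: "'a set" and c :: "'a \<Rightarrow> 'a \<Rightarrow> 'c" and t :: nat
  assumes finite_points: "finite \<Omega>"
    and sym: "x \<in> \<Omega> \<Longrightarrow> y \<in> \<Omega> \<Longrightarrow> c x y = c y x"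
    and diag: "x \<in> \<Omega> \<Longrightarrow> y \<in> \<Omega> \<Longrightarrow> z \<in> \<Omega> \<Longrightarrow> c x y = c z z \<longleftrightarrow> x = y"
    and coherent: "x \<in> \<Omega> \<Longrightarrow> y \<in> \<Omega> \<Longrightarrow> x' \<in> \<Omega> \<Longrightarrow> y' \<in> \<Omega> \<Longrightarrow> c x y = c x' y' \<Longrightarrow>
      card {w \<in> \<Omega>. c x w = i \<and> c y w = j} = card {w \<in> \<Omega>. c x' w = i \<and> c y' w = j}"
    and valency: "x \<in> \<Omega> \<Longrightarrow> y \<in> \<Omega> \<Longrightarrow> w \<in> \<Omega> \<Longrightarrow> y \<noteq> w \<Longrightarrow> card {z \<in> \<Omega>. c x z = c y w} = t"
    and equal_colours: "x \<in> \<Omega> \<Longrightarrow> y \<in> \<Omega> \<Longrightarrow> x \<noteq> y \<Longrightarrow> Suc (card {z \<in> \<Omega>. c x z = c y z}) = t"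
begin

lemma diag':
  assumes "x \<in> \<Omega>" "y \<in> \<Omega>" "z \<in> \<Omega>"
  shows "c z z = c x y \<longleftrightarrow> x = y"
  using diag[OF assms] by (simp add: eq_commute[of "c z z"])

text \<open>Seen from \<open>y\<close>, let \<open>v\<close> have the colour of
  \<open>(y, y')\<close> and \<open>w\<close> the colour of \<open>(x, z)\<close>, and count the
  pairs with \<open>c v w = j\<close>. Each order of counting gives a valency times one of the two
  numbers, and both valencies equal \<open>t\<close>.\<close>

lemma intersection_numbers_swap:
  assumes \<Omega>: "x \<in> \<Omega>" "z \<in> \<Omega>" "y \<in> \<Omega>" "y' \<in> \<Omega>" and "x \<noteq> z" "y \<noteq> y'"
  shows "card {w \<in> \<Omega>. c y w = c x z \<and> c y' w = j} = card {u \<in> \<Omega>. c x u = c y y' \<and> c z u = j}"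
proof -
  let ?A = "{v \<in> \<Omega>. c y v = c y y'}" and ?B = "{w \<in> \<Omega>. c y w = c x z}"
  let ?T = "{(v, w). v \<in> ?A \<and> w \<in> ?B \<and> c v w = j}"
  have fin: "finite ?A" "finite ?B" using finite_points by auto
  have A: "card {w \<in> ?B. c v w = j} = card {w \<in> \<Omega>. c y w = c x z \<and> c y' w = j}" if "v \<in> ?A" for v
    using coherent[of y v y y' "c x z" j] that \<Omega> by (simp add: conj_assoc)
  have 1: "card ?T = t * card {w \<in> \<Omega>. c y w = c x z \<and> c y' w = j}"
    using valency[of y y y'] assms by (simp only: card_pairs(1)[OF fin] sum.cong[OF refl A]) simp
  have B: "card {v \<in> ?A. c v w = j} = card {u \<in> \<Omega>. c x u = c y y' \<and> c z u = j}" if "w \<in> ?B" for w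
  proof -
    have "{v \<in> ?A. c v w = j} = {v \<in> \<Omega>. c y v = c y y' \<and> c w v = j}"
      using that sym by auto
    then show ?thesis
      using coherent[of y w x z "c y y'" j] that \<Omega> by simp
  qed
  have 2: "card ?T = t * card {u \<in> \<Omega>. c x u = c y y' \<and> c z u = j}"
    using valency[of y x z] assms by (simp only: card_pairs(2)[OF fin] sum.cong[OF refl B]) simp
  have "t > 0" using equal_colours[of x z] assms by auto
  then show ?thesis using 1 2 by simp
qed

text \<open>For fixed \<open>z\<close> different from \<open>x\<close>, the swap turns the number of
  \<open>w\<close> into the number of certain points \<open>u\<close> with
  \<open>c u z = c x' z\<close>. Summing over \<open>z\<close> first, for fixed \<open>u\<close>,
  leaves a count governed by \<open>equal_colours\<close>.\<close>

lemma card_matching_pairs: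
  assumes \<Omega>: "x \<in> \<Omega>" "x' \<in> \<Omega>" "y \<in> \<Omega>" "y' \<in> \<Omega>" and "x \<noteq> x'" "y \<noteq> y'"
  shows "int (card {(z, w). z \<in> \<Omega> \<and> w \<in> \<Omega> \<and> c x z = c y w \<and> c x' z = c y' w}) =
    (if c x x' = c y y' then int (card \<Omega>) + (int t)\<^sup>2 - 3 * int t + 2 else (int t)\<^sup>2 - int t)"
proof -
  \<comment> \<open>\<open>\<delta>\<close> has two uses: it is the contribution of
    \<open>z = x\<close>, and it tells whether \<open>x\<close> has to be removed from the sets of
    equal colours below.\<close>
  define \<delta> :: int where "\<delta> = (if c x x' = c y y' then 1 else 0)"
  let ?U = "{u \<in> \<Omega>. c x u = c y y'}"
  have finU: "finite ?U" using finite_points by auto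
  let ?f = "\<lambda>z. int (card {w \<in> \<Omega>. c x z = c y w \<and> c x' z = c y' w})"
  have "int (card {(z, w). z \<in> \<Omega> \<and> w \<in> \<Omega> \<and> c x z = c y w \<and> c x' z = c y' w}) = (\<Sum>z\<in>\<Omega>. ?f z)"
    by (simp add: card_pairs(1)[OF finite_points finite_points])
  also have "\<dots> = ?f x + (\<Sum>z\<in>\<Omega> - {x}. ?f z)"
    using \<Omega> finite_points by (simp add: sum.remove)
  also have "?f x = \<delta>"
  proof -
    have "{w \<in> \<Omega>. c x x = c y w \<and> c x' x = c y' w} = (if c x x' = c y y' then {y} else {})"
      using \<Omega> diag' sym by auto
    then show ?thesis by (simp add: \<delta>_def)
  qed
  also have "(\<Sum>z\<in>\<Omega> - {x}. ?f z) = (\<Sum>z\<in>\<Omega> - {x}. int (card {u \<in> ?U. c u z = c x' z}))"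
  proof (rule sum.cong[OF refl])
    fix z assume z: "z \<in> \<Omega> - {x}"
    have "{w \<in> \<Omega>. c x z = c y w \<and> c x' z = c y' w} = {w \<in> \<Omega>. c y w = c x z \<and> c y' w = c x' z}"
      by auto
    moreover have "{u \<in> ?U. c u z = c x' z} = {u \<in> \<Omega>. c x u = c y y' \<and> c z u = c x' z}"
      using z sym by auto
    ultimately show "?f z = int (card {u \<in> ?U. c u z = c x' z})"
      using intersection_numbers_swap[of x z y y' "c x' z"] z assms by auto
  qed
  also have "\<dots> = (\<Sum>u\<in>?U. int (card {z \<in> \<Omega> - {x}. c u z = c x' z}))"
    using card_pairs[of "\<Omega> - {x}" ?U "\<lambda>z u. c u z = c x' z"] finite_points finU
    by (simp flip: of_nat_sum)
  \<comment> \<open>The exceptional \<open>u = x'\<close> contributes all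
    \<open>card \<Omega> - 1\<close> points, and it lies in \<open>?U\<close> exactly if
    \<open>c x x' = c y y'\<close>. The last summand corrects the generic value accordingly.\<close>
  also have "\<dots> = (\<Sum>u\<in>?U. int t - 1 - \<delta> + (if u = x' then int (card \<Omega>) - int t + \<delta> else 0))"
  proof (rule sum.cong[OF refl])
    fix u assume u: "u \<in> ?U"
    show "int (card {z \<in> \<Omega> - {x}. c u z = c x' z}) =
      int t - 1 - \<delta> + (if u = x' then int (card \<Omega>) - int t + \<delta> else 0)"
    proof (cases "u = x'")
      case True
      have "{z \<in> \<Omega> - {x}. c u z = c x' z} = \<Omega> - {x}"
        using True by auto
      then show ?thesis
        using True \<Omega> finite_points by (simp only: int_card_Diff_singleton) simp
    next
      case False
      have *: "Suc (card {z \<in> \<Omega>. c u z = c x' z}) = t"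
        using False u \<Omega> by (intro equal_colours) auto
      have eq: "{z \<in> \<Omega> - {x}. c u z = c x' z} = {z \<in> \<Omega>. c u z = c x' z} - {x}" by auto
      have "x \<in> {z \<in> \<Omega>. c u z = c x' z} \<longleftrightarrow> c x x' = c y y'"
        using u \<Omega> sym by auto
      then have "int (card ({z \<in> \<Omega>. c u z = c x' z} - {x})) = int (card {z \<in> \<Omega>. c u z = c x' z}) - \<delta>"
        using finite_points
        by (cases "c x x' = c y y'") (simp_all add: \<delta>_def int_card_Diff_singleton del: mem_Collect_eq Diff_iff card_Diff_insert card_Diff_singleton)
      note this[folded eq]
      then show ?thesis using * False by simp
    qed
  qed
  also have "\<dots> = int t * (int t - 1 - \<delta>) + (if c x x' = c y y' then int (card \<Omega>) - int t + \<delta> else 0)"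
    using valency[of x y y'] assms finU by (simp add: sum.distrib)
  finally show ?thesis
    by (simp add: \<delta>_def power2_eq_square algebra_simps split: if_splits)
qed

text \<open>Distinctness of the first coordinates suffices: by \<open>diag\<close>, equal colours on
  \<Omega> then make the second coordinates distinct too.\<close>

definition adj :: "'a \<times> 'a \<Rightarrow> 'a \<times> 'a \<Rightarrow> bool" where
  "adj p p' \<longleftrightarrow> fst p \<noteq> fst p' \<and> c (fst p) (fst p') = c (snd p) (snd p')"

lemma card_neighbours:
  assumes "p \<in> \<Omega> \<times> \<Omega>"
  shows "int (card {r \<in> \<Omega> \<times> \<Omega>. adj p r}) = int t * (int (card \<Omega>) - 1)"
proof -
  obtain x y where p: "p = (x, y)" "x \<in> \<Omega>" "y \<in> \<Omega>" using assms by auto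
  have "{r \<in> \<Omega> \<times> \<Omega>. adj p r} = {(z, w). z \<in> \<Omega> - {x} \<and> w \<in> \<Omega> \<and> c y w = c x z}"
    using p by (auto simp: adj_def)
  then have "card {r \<in> \<Omega> \<times> \<Omega>. adj p r} = (\<Sum>z\<in>\<Omega> - {x}. card {w \<in> \<Omega>. c y w = c x z})"
    using card_pairs(1)[of "\<Omega> - {x}" \<Omega>] finite_points by simp
  also have "\<dots> = (\<Sum>z\<in>\<Omega> - {x}. t)"
    using p by (intro sum.cong refl valency) auto
  finally show ?thesis
    using p finite_points by (simp add: int_card_Diff_singleton del: card_Diff_insert)
qed

text \<open>If \<open>p\<close> and \<open>p'\<close> share one coordinate, the other coordinate of
  a common neighbour has \<open>t - 1\<close> choices by \<open>equal_colours\<close>, and each of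
  them leaves \<open>t\<close> choices for the shared one. If both coordinates differ,
  \<open>card_matching_pairs\<close> applies.\<close>

lemma card_common_neighbours:
  assumes "p \<in> \<Omega> \<times> \<Omega>" "p' \<in> \<Omega> \<times> \<Omega>" "p \<noteq> p'"
  shows "int (card {r \<in> \<Omega> \<times> \<Omega>. adj p r \<and> adj p' r}) =
    (if adj p p' then int (card \<Omega>) + (int t)\<^sup>2 - 3 * int t else (int t)\<^sup>2 - int t)"
proof -
  obtain x y where p: "p = (x, y)" "x \<in> \<Omega>" "y \<in> \<Omega>" using assms by auto
  obtain x' y' where p': "p' = (x', y')" "x' \<in> \<Omega>" "y' \<in> \<Omega>" using assms by auto
  let ?C = "{r \<in> \<Omega> \<times> \<Omega>. adj p r \<and> adj p' r}"
  consider "x = x'" "y \<noteq> y'" | "x \<noteq> x'" "y = y'" | "x \<noteq> x'" "y \<noteq> y'"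
    using assms p p' by auto
  then show ?thesis
  proof cases
    case 1
    let ?W = "{w \<in> \<Omega>. c y w = c y' w}"
    have W: "y \<notin> ?W" "y' \<notin> ?W" using 1 p p' diag diag' by auto
    have "?C = {(z, w). z \<in> \<Omega> \<and> w \<in> ?W \<and> c x z = c y w}"
      using 1 p p' W by (auto simp: adj_def diag diag')
    then have "card ?C = (\<Sum>w\<in>?W. card {z \<in> \<Omega>. c x z = c y w})"
      using card_pairs(2)[of \<Omega> ?W] finite_points by simp
    also have "\<dots> = (\<Sum>w\<in>?W. t)"
      using W p by (intro sum.cong refl valency) auto
    finally have "int (card ?C) = (int t - 1) * int t"
      using equal_colours[of y y'] 1 p p' by auto
    moreover have "\<not> adj p p'" using 1 p p' by (simp add: adj_def)
    ultimately show ?thesis by (simp add: power2_eq_square algebra_simps)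
  next
    case 2
    let ?W = "{z \<in> \<Omega>. c x z = c x' z}"
    have W: "x \<notin> ?W" "x' \<notin> ?W" using 2 p p' diag diag' by auto
    have "?C = {(z, w). z \<in> ?W \<and> w \<in> \<Omega> \<and> c y w = c x z}"
      using 2 p p' W by (auto simp: adj_def)
    then have "card ?C = (\<Sum>z\<in>?W. card {w \<in> \<Omega>. c y w = c x z})"
      using card_pairs(1)[of ?W \<Omega>] finite_points by simp
    also have "\<dots> = (\<Sum>w\<in>?W. t)"
      using W p by (intro sum.cong refl valency) auto
    finally have "int (card ?C) = (int t - 1) * int t"
      using equal_colours[of x x'] 2 p p' by auto
    moreover have "\<not> adj p p'" using 2 p p' diag by (simp add: adj_def)
    ultimately show ?thesis by (simp add: power2_eq_square algebra_simps)
  next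
    case 3
    let ?S = "{(z, w). z \<in> \<Omega> \<and> w \<in> \<Omega> \<and> c x z = c y w \<and> c x' z = c y' w}"
    \<comment> \<open>\<open>card_matching_pairs\<close> also counts \<open>p\<close> and
      \<open>p'\<close> themselves if these are adjacent, which accounts for the \<open>+ 2\<close>
      there.\<close>
    let ?D = "if c x x' = c y y' then {(x, y), (x', y')} else {}"
    have adj: "adj p p' \<longleftrightarrow> c x x' = c y y'"
      using 3 p p' by (simp add: adj_def)
    have eq: "c x x = c y w \<longleftrightarrow> w = y" "c x' x' = c y' w \<longleftrightarrow> w = y'" if "w \<in> \<Omega>" for w
      using that p p' diag'[of y w x] diag'[of y' w x'] by auto
    have sym': "c x' x = c x x'" "c y' y = c y y'"
      using p p' sym by auto
    have "(z, w) \<in> ?S \<longleftrightarrow> (z, w) \<in> ?C \<union> ?D" for z w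
    proof -
      consider "z = x" | "z = x'" | "z \<noteq> x" "z \<noteq> x'" by blast
      then show ?thesis
      proof cases
        case 1
        have "c x x = c y w \<and> c x' x = c y' w \<longleftrightarrow> w = y \<and> c x x' = c y y'" if "w \<in> \<Omega>"
          using eq[OF that] sym' by metis
        moreover have "(x, w) \<notin> ?C"
          using p by (simp add: adj_def)
        moreover have "(x, w) \<in> ?D \<longleftrightarrow> w = y \<and> c x x' = c y y'"
          using \<open>x \<noteq> x'\<close> by auto
        ultimately show ?thesis
          using 1 p by (cases "w \<in> \<Omega>") (simp_all del: if_split, metis+)
      next
        case 2
        have "c x x' = c y w \<and> c x' x' = c y' w \<longleftrightarrow> w = y' \<and> c x x' = c y y'" if "w \<in> \<Omega>"
          using eq[OF that] sym' by metis
        moreover have "(x', w) \<notin> ?C"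
          using p' by (simp add: adj_def)
        moreover have "(x', w) \<in> ?D \<longleftrightarrow> w = y' \<and> c x x' = c y y'"
          using \<open>x \<noteq> x'\<close> by auto
        ultimately show ?thesis
          using 2 p' by (cases "w \<in> \<Omega>") (simp_all del: if_split, metis+)
      next
        case 3
        then show ?thesis using p p' by (simp add: adj_def)
      qed
    qed
    then have "?S = ?C \<union> ?D" by (simp add: set_eq_iff del: Un_iff)
    moreover have "?C \<inter> ?D = {}"
      using p p' by (auto simp: adj_def)
    moreover have "finite ?C" using finite_points by simp
    ultimately have "card ?S = card ?C + card ?D"
      by (simp add: card_Un_disjoint)
    moreover have "card ?D = (if c x x' = c y y' then 2 else 0)"
      using 3 by simp
    ultimately show ?thesis
      using card_matching_pairs[of x x' y y'] p p' 3 adj by (simp split: if_splits)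
  qed
qed

lemma strongly_regular_latin_square_type:
  "\<exists>G :: nat pair_pre_digraph. strongly_regular G ((int (card \<Omega>))\<^sup>2) (int t * (int (card \<Omega>) - 1))
     (int (card \<Omega>) + (int t)\<^sup>2 - 3 * int t) ((int t)\<^sup>2 - int t)"
proof (rule strongly_regular_nat_graphI[of "\<Omega> \<times> \<Omega>" adj])
  show "adj r p" if "p \<in> \<Omega> \<times> \<Omega>" "r \<in> \<Omega> \<times> \<Omega>" "adj p r" for p r
    using that sym by (auto simp: adj_def)
  show "\<not> adj p p" for p by (simp add: adj_def)
qed (use finite_points card_neighbours card_common_neighbours in
    \<open>auto simp: card_cartesian_product power2_eq_square adj_def\<close>)

end

section \<open>Fusing the colours of a homogeneous scheme\<close>

locale homogeneous =
  fixes \<Omega> :: "'a set" and r :: "'a \<Rightarrow> 'a \<Rightarrow> 'c" and d :: nat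
  assumes finite_points: "finite \<Omega>"
    and sym: "x \<in> \<Omega> \<Longrightarrow> y \<in> \<Omega> \<Longrightarrow> r x y = r y x"
    and diag: "x \<in> \<Omega> \<Longrightarrow> y \<in> \<Omega> \<Longrightarrow> z \<in> \<Omega> \<Longrightarrow> r x y = r z z \<longleftrightarrow> x = y"
    and transitive: "x \<in> \<Omega> \<Longrightarrow> y \<in> \<Omega> \<Longrightarrow> x' \<in> \<Omega> \<Longrightarrow> y' \<in> \<Omega> \<Longrightarrow> r x y = r x' y' \<Longrightarrow>
      \<exists>g. g ` \<Omega> \<subseteq> \<Omega> \<and> (\<forall>u\<in>\<Omega>. \<forall>v\<in>\<Omega>. r (g u) (g v) = r u v) \<and> g x = x' \<and> g y = y'"
    and valency: "x \<in> \<Omega> \<Longrightarrow> y \<in> \<Omega> \<Longrightarrow> w \<in> \<Omega> \<Longrightarrow> y \<noteq> w \<Longrightarrow> card {z \<in> \<Omega>. r x z = r y w} = d"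
begin

text \<open>Elements of \<open>G\<close> fix everything outside \<Omega>, which makes this
  automorphism group of the colouring finite.\<close>

definition G :: "('a \<Rightarrow> 'a) set" where
  "G = {g. g permutes \<Omega> \<and> (\<forall>u\<in>\<Omega>. \<forall>v\<in>\<Omega>. r (g u) (g v) = r u v)}"

lemma finite_G: "finite G"
  using finite_permutations[OF finite_points] by (rule rev_finite_subset) (auto simp: G_def)

lemma G_in_points: "g \<in> G \<Longrightarrow> g x \<in> \<Omega> \<longleftrightarrow> x \<in> \<Omega>"
  by (simp add: G_def permutes_in_image)

lemma G_eq_iff: "g \<in> G \<Longrightarrow> g x = g y \<longleftrightarrow> x = y"
  by (auto simp: G_def dest!: permutes_inj dest: injD)

lemma G_preserves: "g \<in> G \<Longrightarrow> u \<in> \<Omega> \<Longrightarrow> v \<in> \<Omega> \<Longrightarrow> r (g u) (g v) = r u v"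
  by (simp add: G_def)

lemma G_comp: "g \<in> G \<Longrightarrow> h \<in> G \<Longrightarrow> g \<circ> h \<in> G"
  by (auto simp: G_def permutes_in_image intro: permutes_compose)

text \<open>Colour preserving maps are injective by \<open>diag\<close>, hence bijective on the
  finite set \<Omega>. Replacing them by the identity outside \<Omega> gives members of
  \<open>G\<close>.\<close>

lemma G_transitive:
  assumes \<Omega>: "x \<in> \<Omega>" "y \<in> \<Omega>" "x' \<in> \<Omega>" "y' \<in> \<Omega>" and "r x y = r x' y'"
  shows "\<exists>g\<in>G. g x = x' \<and> g y = y'"
proof -
  obtain g where g: "g ` \<Omega> \<subseteq> \<Omega>" "\<forall>u\<in>\<Omega>. \<forall>v\<in>\<Omega>. r (g u) (g v) = r u v" "g x = x'" "g y = y'"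
    using transitive[OF assms] by blast
  have "inj_on g \<Omega>"
    using g diag by (intro inj_onI) (metis image_subset_iff)
  then have "bij_betw g \<Omega> \<Omega>"
    using g(1) finite_points by (simp add: bij_betw_def endo_inj_surj)
  then have "(\<lambda>u. if u \<in> \<Omega> then g u else u) permutes \<Omega>"
    by (intro bij_imp_permutes) (auto cong: bij_betw_cong)
  then have "(\<lambda>u. if u \<in> \<Omega> then g u else u) \<in> G"
    using g by (auto simp: G_def)
  then show ?thesis
    using g \<Omega> by (intro bexI) auto
qed

text \<open>Left translation by \<open>h\<close> is an injection of the finite set \<open>G\<close>
  into itself, hence a bijection. It serves to compare the sizes of transporter sets.\<close>

lemma card_translate:
  assumes h: "h \<in> G"
  shows "card {g \<in> G. P (h \<circ> g)} = card {g \<in> G. P g}"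
proof -
  have inj: "inj_on ((\<circ>) h) G"
    using h by (auto simp: inj_on_def fun_eq_iff G_eq_iff)
  then have G: "(\<circ>) h ` G = G"
    using h finite_G by (intro endo_inj_surj) (auto simp: G_comp)
  have "(\<circ>) h ` {g \<in> G. P (h \<circ> g)} = {g \<in> G. P g}"
    by (subst (2) G[symmetric]) auto
  then have "card {g \<in> G. P g} = card ((\<circ>) h ` {g \<in> G. P (h \<circ> g)})"
    by simp
  also have "\<dots> = card {g \<in> G. P (h \<circ> g)}"
    using inj by (intro card_image) (rule inj_on_subset, auto)
  finally show ?thesis ..
qed

text \<open>Orbit-stabiliser: the sets of \<open>g\<close> with a prescribed image of
  \<open>x\<close> partition \<open>G\<close>, and translations show that they have equal
  size.\<close>

lemma card_transporter:
  assumes "x \<in> \<Omega>" "x' \<in> \<Omega>"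
  shows "card \<Omega> * card {g \<in> G. g x = x'} = card G"
proof -
  have "card {g \<in> G. g x = x''} = card {g \<in> G. g x = x'}" if x'': "x'' \<in> \<Omega>" for x''
  proof -
    have "r x'' x'' = r x' x'" using diag assms x'' by blast
    then obtain h where h: "h \<in> G" "h x'' = x'"
      using G_transitive[of x'' x'' x' x'] assms x'' by blast
    have "{g \<in> G. (h \<circ> g) x = x'} = {g \<in> G. g x = x''}"
      using h G_eq_iff by auto
    then show ?thesis using card_translate[OF h(1), of "\<lambda>g. g x = x'"] by simp
  qed
  then have "card \<Omega> * card {g \<in> G. g x = x'} = (\<Sum>x''\<in>\<Omega>. card {g \<in> G. g x = x''})"
    by simp
  also have "\<dots> = card (\<Union>x''\<in>\<Omega>. {g \<in> G. g x = x''})"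
    using finite_points finite_G by (subst card_UN_disjoint) auto
  also have "(\<Union>x''\<in>\<Omega>. {g \<in> G. g x = x''}) = G"
    using assms G_in_points by auto
  finally show ?thesis .
qed

text \<open>Orbit-stabiliser one level down: once \<open>g x = x'\<close>, the image of
  \<open>y\<close> ranges over the \<open>d\<close> points that have colour \<open>r x y\<close>
  with \<open>x'\<close>.\<close>

lemma card_transporter2:
  assumes \<Omega>: "x \<in> \<Omega>" "y \<in> \<Omega>" "x' \<in> \<Omega>" "y' \<in> \<Omega>" and "x \<noteq> y" and r: "r x' y' = r x y"
  shows "d * card {g \<in> G. g x = x' \<and> g y = y'} = card {g \<in> G. g x = x'}"
proof -
  let ?Y = "{y'' \<in> \<Omega>. r x' y'' = r x y}"
  have "card {g \<in> G. g x = x' \<and> g y = y''} = card {g \<in> G. g x = x' \<and> g y = y'}" if y'': "y'' \<in> ?Y" for y''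
  proof -
    obtain h where h: "h \<in> G" "h x' = x'" "h y'' = y'"
      using G_transitive[of x' y'' x' y'] \<Omega> y'' r by auto
    have "{g \<in> G. (h \<circ> g) x = x' \<and> (h \<circ> g) y = y'} = {g \<in> G. g x = x' \<and> g y = y''}"
      using h G_eq_iff by (metis comp_apply)
    then show ?thesis using card_translate[OF h(1), of "\<lambda>g. g x = x' \<and> g y = y'"] by simp
  qed
  then have "card ?Y * card {g \<in> G. g x = x' \<and> g y = y'} = (\<Sum>y''\<in>?Y. card {g \<in> G. g x = x' \<and> g y = y''})"
    by simp
  also have "\<dots> = card (\<Union>y''\<in>?Y. {g \<in> G. g x = x' \<and> g y = y''})"
    using finite_points finite_G by (subst card_UN_disjoint) auto
  also have "(\<Union>y''\<in>?Y. {g \<in> G. g x = x' \<and> g y = y''}) = {g \<in> G. g x = x'}"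
    using \<Omega> G_in_points G_preserves by auto
  finally show ?thesis using valency[of x' x y] assms by simp
qed

text \<open>
  Each \<open>g \<circ> s\<close> with \<open>g \<in> G\<close> has at most one fixed point, because two of them would have
  their colour preserved by \<open>s\<close>; by transitivity the average number of fixed points is 1.
\<close>

lemma card_twisted_fixed_points:
  assumes ne: "\<Omega> \<noteq> {}" and s: "s ` \<Omega> \<subseteq> \<Omega>"
    and s': "\<And>x y. x \<in> \<Omega> \<Longrightarrow> y \<in> \<Omega> \<Longrightarrow> x \<noteq> y \<Longrightarrow> r (s x) (s y) \<noteq> r x y"
    and g: "g \<in> G"
  shows "card {z \<in> \<Omega>. g (s z) = z} = 1"
proof -
  have le: "card {z \<in> \<Omega>. h (s z) = z} \<le> 1" if h: "h \<in> G" for h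
  proof -
    have "x = y" if "x \<in> \<Omega>" "h (s x) = x" "y \<in> \<Omega>" "h (s y) = y" for x y
      using s s'[of x y] G_preserves[OF h, of "s x" "s y"] that by force
    moreover have "finite {z \<in> \<Omega>. h (s z) = z}"
      using finite_points by simp
    ultimately show ?thesis
      unfolding One_nat_def by (subst card_le_Suc0_iff_eq) auto
  qed
  have "(\<Sum>z\<in>\<Omega>. card {h \<in> G. h (s z) = z}) * card \<Omega> = (\<Sum>z\<in>\<Omega>. card G)"
    unfolding sum_distrib_right
  proof (rule sum.cong[OF refl])
    fix z assume "z \<in> \<Omega>"
    then show "card {h \<in> G. h (s z) = z} * card \<Omega> = card G"
      using card_transporter[of "s z" z] s by (auto simp: mult.commute)
  qed
  then have "(\<Sum>z\<in>\<Omega>. card {h \<in> G. h (s z) = z}) = card G"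
    using ne finite_points by simp
  then have "(\<Sum>h\<in>G. card {z \<in> \<Omega>. h (s z) = z}) = (\<Sum>h\<in>G. 1)"
    using card_pairs[OF finite_G finite_points, of "\<lambda>h z. h (s z) = z"] by simp
  from sum_mono_inv[OF this le g finite_G] show ?thesis by simp
qed

text \<open>
  Count the pairs \<open>(g, z)\<close> such that \<open>g \<circ> s\<close> maps \<open>y\<close> to \<open>x\<close> and fixes \<open>z\<close>.
\<close>

lemma card_twisted_colours:
  assumes s: "s ` \<Omega> \<subseteq> \<Omega>" "inj_on s \<Omega>"
    and s': "\<And>x y. x \<in> \<Omega> \<Longrightarrow> y \<in> \<Omega> \<Longrightarrow> x \<noteq> y \<Longrightarrow> r (s x) (s y) \<noteq> r x y"
    and X: "x \<in> \<Omega>" "y \<in> \<Omega>" "x \<noteq> y"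
  shows "card {z \<in> \<Omega>. r x z = r (s y) (s z)} = d"
proof -
  let ?H = "{g \<in> G. g (s y) = x}"
  have fin: "finite ?H" using finite_G by simp
  have sX: "s z \<in> \<Omega>" if "z \<in> \<Omega>" for z using s(1) that by blast
  have "card ?H = (\<Sum>g\<in>?H. card {z \<in> \<Omega>. g (s z) = z})"
    using card_twisted_fixed_points[OF _ s(1) s'] X by (subst sum.cong[OF refl, of _ _ "\<lambda>_. 1"]) auto
  also have "\<dots> = (\<Sum>z\<in>\<Omega>. card {g \<in> ?H. g (s z) = z})"
    using card_pairs[OF fin finite_points, of "\<lambda>g z. g (s z) = z"] by simp
  finally have "d * card ?H = (\<Sum>z\<in>\<Omega>. d * card {g \<in> ?H. g (s z) = z})"
    by (simp only: sum_distrib_left)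
  \<comment> \<open>An element of \<open>G\<close> can send \<open>s y\<close> to \<open>x\<close>
    and \<open>s z\<close> to \<open>z\<close> only if the colours agree. In that case
    \<open>s y\<close> and \<open>s z\<close> differ and \<open>card_transporter2\<close>
    applies.\<close>
  also have "\<dots> = (\<Sum>z\<in>\<Omega>. if r x z = r (s y) (s z) then card ?H else 0)"
  proof (rule sum.cong[OF refl])
    fix z assume z: "z \<in> \<Omega>"
    have eq: "{g \<in> ?H. g (s z) = z} = {g \<in> G. g (s y) = x \<and> g (s z) = z}" by auto
    show "d * card {g \<in> ?H. g (s z) = z} = (if r x z = r (s y) (s z) then card ?H else 0)"
    proof (cases "r x z = r (s y) (s z)")
      case True
      have "s y \<noteq> s z"
      proof
        assume "s y = s z"
        then have "r x z = r x x" using True diag[of "s z" "s z" x] sX z X by simp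
        then have "x = z" using diag X z by blast
        with \<open>s y = s z\<close> show False using s X z by (auto dest: inj_onD)
      qed
      then show ?thesis
        using card_transporter2[of "s y" "s z" x z] True X z sX eq by simp
    next
      case False
      have "\<not> (g \<in> G \<and> g (s y) = x \<and> g (s z) = z)" for g
      proof (rule notI, elim conjE)
        assume g: "g \<in> G" "g (s y) = x" "g (s z) = z"
        show False using False G_preserves[OF g(1) sX[OF X(2)] sX[OF z]] unfolding g(2,3) ..
      qed
      then have "{g \<in> ?H. g (s z) = z} = {}" by blast
      then show ?thesis using False by (simp only: card.empty if_False mult_0_right)
    qed
  qed
  also have "\<dots> = card {z \<in> \<Omega>. r x z = r (s y) (s z)} * card ?H"
    using finite_points by (simp add: sum.If_cases Int_def)
  finally have "d * card ?H = card {z \<in> \<Omega>. r x z = r (s y) (s z)} * card ?H" .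
  moreover have "card ?H > 0"
  proof -
    have "r (s y) (s y) = r x x" using diag sX X by blast
    then show ?thesis
      using G_transitive[of "s y" "s y" x x] sX X fin by (auto simp: card_gt_0_iff)
  qed
  ultimately show ?thesis by simp
qed

end

text \<open>By \<open>s_compat\<close> the map \<open>s\<close> acts on colours, and by
  \<open>s_period\<close> and \<open>s_moves\<close> its orbits on nontrivial colours all have
  length \<open>m\<close>. The assumption \<open>equal\<close> says that the original scheme is
  itself pseudocyclic.\<close>

locale fused = homogeneous \<Omega> r d for \<Omega> :: "'a set" and r :: "'a \<Rightarrow> 'a \<Rightarrow> 'c" and d +
  fixes s :: "'a \<Rightarrow> 'a" and m :: nat
  assumes m_pos: "0 < m"
    and s_in_points: "x \<in> \<Omega> \<Longrightarrow> s x \<in> \<Omega>"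
    and s_period: "x \<in> \<Omega> \<Longrightarrow> (s ^^ m) x = x"
    and s_compat: "x \<in> \<Omega> \<Longrightarrow> y \<in> \<Omega> \<Longrightarrow> x' \<in> \<Omega> \<Longrightarrow> y' \<in> \<Omega> \<Longrightarrow> r x y = r x' y' \<Longrightarrow>
      r (s x) (s y) = r (s x') (s y')"
    and s_moves: "x \<in> \<Omega> \<Longrightarrow> y \<in> \<Omega> \<Longrightarrow> x \<noteq> y \<Longrightarrow> 0 < i \<Longrightarrow> i < m \<Longrightarrow>
      r ((s ^^ i) x) ((s ^^ i) y) \<noteq> r x y"
    and equal: "x \<in> \<Omega> \<Longrightarrow> y \<in> \<Omega> \<Longrightarrow> x \<noteq> y \<Longrightarrow> Suc (card {z \<in> \<Omega>. r x z = r y z}) = d"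
begin

text \<open>A fused colour is a whole orbit of colours, so that lying in one orbit becomes equality
  of values.\<close>

definition c :: "'a \<Rightarrow> 'a \<Rightarrow> 'c set" where
  "c x y = {r ((s ^^ i) x) ((s ^^ i) y) | i. i < m}"

lemma iter_in_points: "x \<in> \<Omega> \<Longrightarrow> (s ^^ i) x \<in> \<Omega>"
  by (induction i) (auto simp: s_in_points)

lemma iter_compat:
  assumes "x \<in> \<Omega>" "y \<in> \<Omega>" "x' \<in> \<Omega>" "y' \<in> \<Omega>" "r x y = r x' y'"
  shows "r ((s ^^ i) x) ((s ^^ i) y) = r ((s ^^ i) x') ((s ^^ i) y')"
  by (induction i) (use assms s_compat iter_in_points in auto)

lemma iter_mod:
  assumes "x \<in> \<Omega>"
  shows "(s ^^ (i mod m)) x = (s ^^ i) x"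
proof -
  have "(s ^^ (m * j)) x = x" for j
    by (induction j) (use assms s_period in \<open>auto simp: funpow_add\<close>)
  moreover have "(s ^^ i) x = (s ^^ (i mod m)) ((s ^^ (m * (i div m))) x)"
    by (metis comp_apply funpow_add mod_mult_div_eq)
  ultimately show ?thesis by simp
qed

lemma c_eq_range:
  assumes "x \<in> \<Omega>" "y \<in> \<Omega>"
  shows "c x y = range (\<lambda>i. r ((s ^^ i) x) ((s ^^ i) y))"
proof -
  have "r ((s ^^ i) x) ((s ^^ i) y) \<in> c x y" for i
    unfolding c_def using m_pos iter_mod[OF assms(1), of i] iter_mod[OF assms(2), of i]
    by (auto intro!: exI[of _ "i mod m"])
  then show ?thesis by (auto simp: c_def)
qed

text \<open>Completing to a multiple of the period, \<open>s ^^ (m * i - i)\<close> undoes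
  \<open>s ^^ i\<close> on \<Omega>.\<close>

lemma inj_iter: "inj_on (s ^^ i) \<Omega>"
proof (rule inj_onI)
  fix x y assume X: "x \<in> \<Omega>" "y \<in> \<Omega>" and "(s ^^ i) x = (s ^^ i) y"
  then have "(s ^^ (m * i - i)) ((s ^^ i) x) = (s ^^ (m * i - i)) ((s ^^ i) y)"
    by simp
  moreover have "(s ^^ (m * i - i)) ((s ^^ i) z) = z" if "z \<in> \<Omega>" for z
  proof -
    have "i \<le> m * i" using m_pos by simp
    then have "m * i - i + i = m * i" by linarith
    then have "(s ^^ (m * i - i)) ((s ^^ i) z) = (s ^^ (m * i)) z"
      by (metis comp_apply funpow_add)
    also have "\<dots> = z" using iter_mod[OF that, of "m * i"] by simp
    finally show ?thesis .
  qed
  ultimately show "x = y" using X by simp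
qed

lemma iter_diag: "x \<in> \<Omega> \<Longrightarrow> y \<in> \<Omega> \<Longrightarrow> r ((s ^^ i) x) ((s ^^ i) x) = r y y"
  using diag iter_in_points by blast

lemma c_iter:
  assumes "x \<in> \<Omega>" "y \<in> \<Omega>"
  shows "c ((s ^^ i) x) ((s ^^ i) y) = c x y"
proof
  have eq: "(s ^^ j) ((s ^^ i) z) = (s ^^ (j + i)) z" for j z
    by (simp add: funpow_add)
  show "c ((s ^^ i) x) ((s ^^ i) y) \<subseteq> c x y"
    using assms iter_in_points by (auto simp: c_eq_range eq)
  have shift: "(s ^^ j) z = (s ^^ (j + (m * i - i))) ((s ^^ i) z)" if "z \<in> \<Omega>" for j z
  proof -
    have "i \<le> m * i" using m_pos by simp
    then have "j + (m * i - i) + i = j + m * i" by linarith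
    then show ?thesis using iter_mod[OF that, of "j + m * i"] iter_mod[OF that, of j] by (simp only: eq mod_mult_self2)
  qed
  show "c x y \<subseteq> c ((s ^^ i) x) ((s ^^ i) y)"
  proof
    fix a assume "a \<in> c x y"
    then obtain j where "a = r ((s ^^ j) x) ((s ^^ j) y)"
      by (auto simp: c_def)
    then have "a = r ((s ^^ (j + (m * i - i))) ((s ^^ i) x)) ((s ^^ (j + (m * i - i))) ((s ^^ i) y))"
      by (simp only: shift[OF assms(1), of j] shift[OF assms(2), of j])
    then show "a \<in> c ((s ^^ i) x) ((s ^^ i) y)"
      using c_eq_range iter_in_points assms by blast
  qed
qed

text \<open>Orbits that share a colour coincide, since by \<open>iter_compat\<close> a colour
  determines its whole orbit.\<close>

lemma c_eq_iff:
  assumes "x \<in> \<Omega>" "y \<in> \<Omega>" "x' \<in> \<Omega>" "y' \<in> \<Omega>"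
  shows "c x y = c x' y' \<longleftrightarrow> (\<exists>i<m. r x y = r ((s ^^ i) x') ((s ^^ i) y'))"
proof
  assume "c x y = c x' y'"
  moreover have "r x y \<in> c x y"
    using m_pos by (auto simp: c_def intro!: exI[of _ 0])
  ultimately show "\<exists>i<m. r x y = r ((s ^^ i) x') ((s ^^ i) y')"
    by (auto simp: c_def)
next
  assume "\<exists>i<m. r x y = r ((s ^^ i) x') ((s ^^ i) y')"
  then obtain i where i: "r x y = r ((s ^^ i) x') ((s ^^ i) y')" by blast
  have "c x y = c ((s ^^ i) x') ((s ^^ i) y')"
    unfolding c_def using iter_compat[OF assms(1,2) _ _ i] assms iter_in_points by simp
  then show "c x y = c x' y'" using c_iter assms by simp
qed

lemma iter_moves:
  assumes "x \<in> \<Omega>" "y \<in> \<Omega>" "x \<noteq> y" "i < m" "j < m" "i \<noteq> j"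
  shows "r ((s ^^ i) x) ((s ^^ i) y) \<noteq> r ((s ^^ j) x) ((s ^^ j) y)"
  using assms(4-6)
proof (induction i j rule: linorder_wlog)
  case (le i j)
  have "(s ^^ i) x \<noteq> (s ^^ i) y"
    using inj_iter[of i] assms by (auto dest: inj_onD)
  moreover have "(s ^^ (j - i)) ((s ^^ i) z) = (s ^^ j) z" for z
    using le by (metis comp_apply funpow_add le_add_diff_inverse2)
  moreover have "0 < j - i" "j - i < m"
    using le by linarith+
  ultimately show ?case
    using s_moves[of "(s ^^ i) x" "(s ^^ i) y" "j - i"] assms iter_in_points by auto
next
  case (sym i j)
  then show ?case by metis
qed

text \<open>A fused colour class at a point is a disjoint union of \<open>m\<close> classes of size
  \<open>d\<close>. Pairs of equal fused colours split by the exponent \<open>i\<close>: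
  \<open>i = 0\<close> gives \<open>d - 1\<close> points by \<open>equal\<close>, each other
  \<open>i\<close> gives \<open>d\<close> points by \<open>card_twisted_colours\<close>, in total
  \<open>m * d - 1\<close>.\<close>

lemma pseudocyclic_fused: "pseudocyclic \<Omega> c (m * d)"
proof
  show "finite \<Omega>" by (rule finite_points)
  show "c x y = c y x" if "x \<in> \<Omega>" "y \<in> \<Omega>" for x y
    using that sym iter_in_points by (simp add: c_def)
  show "c x y = c z z \<longleftrightarrow> x = y" if X: "x \<in> \<Omega>" "y \<in> \<Omega>" "z \<in> \<Omega>" for x y z
    using c_eq_iff[OF X(1,2) X(3,3)] iter_diag[OF X(3) X(3)] diag[OF X] m_pos by auto
next
  fix x y x' y' i j
  assume X: "x \<in> \<Omega>" "y \<in> \<Omega>" "x' \<in> \<Omega>" "y' \<in> \<Omega>" and "c x y = c x' y'"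
  then obtain k where "r x y = r ((s ^^ k) x') ((s ^^ k) y')"
    using c_eq_iff by blast
  then obtain g where g: "g \<in> G" "g x = (s ^^ k) x'" "g y = (s ^^ k) y'"
    using G_transitive X iter_in_points by meson
  \<comment> \<open>Both \<open>g\<close> and \<open>s ^^ k\<close> permute \<Omega> and preserve
    \<open>c\<close>, so each of them transports the set to be counted.\<close>
  have cg: "c (g u) (g v) = c u v" if "u \<in> \<Omega>" "v \<in> \<Omega>" for u v
    using that g G_preserves[of g u v] c_eq_iff[of "g u" "g v" u v] G_in_points m_pos by force
  have eq: "(s ^^ k) ` \<Omega> = \<Omega>"
    using finite_points inj_iter iter_in_points by (intro endo_inj_surj) auto
  have eq': "g ` \<Omega> = \<Omega>"
    using g by (auto simp: G_def permutes_image)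
  have "card {w \<in> \<Omega>. c x w = i \<and> c y w = j} = card (g ` {w \<in> \<Omega>. c x w = i \<and> c y w = j})"
    using g G_eq_iff by (intro card_image[symmetric]) (auto simp: inj_on_def)
  also have "g ` {w \<in> \<Omega>. c x w = i \<and> c y w = j} = {w \<in> g ` \<Omega>. c (g x) w = i \<and> c (g y) w = j}"
    using X cg by auto
  also have "\<dots> = {w \<in> (s ^^ k) ` \<Omega>. c ((s ^^ k) x') w = i \<and> c ((s ^^ k) y') w = j}"
    by (simp only: eq eq' g)
  also have "\<dots> = (s ^^ k) ` {w \<in> \<Omega>. c x' w = i \<and> c y' w = j}"
    using X c_iter by auto
  also have "card \<dots> = card {w \<in> \<Omega>. c x' w = i \<and> c y' w = j}"
    by (intro card_image inj_on_subset[OF inj_iter]) auto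
  finally show "card {w \<in> \<Omega>. c x w = i \<and> c y w = j} = card {w \<in> \<Omega>. c x' w = i \<and> c y' w = j}" .
next
  fix x y w assume X: "x \<in> \<Omega>" "y \<in> \<Omega>" "w \<in> \<Omega>" "y \<noteq> w"
  let ?A = "\<lambda>i. {z \<in> \<Omega>. r x z = r ((s ^^ i) y) ((s ^^ i) w)}"
  have "{z \<in> \<Omega>. c x z = c y w} = (\<Union>i\<in>{..<m}. ?A i)"
    using c_eq_iff[OF X(1) _ X(2,3)] by blast
  also have "card \<dots> = (\<Sum>i<m. card (?A i))"
    using finite_points iter_moves[OF X(2-4)] by (intro card_UN_disjoint) fastforce+
  also have "\<dots> = (\<Sum>i<m. d)"
    using X inj_iter by (intro sum.cong refl valency iter_in_points) (auto dest: inj_onD)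
  finally show "card {z \<in> \<Omega>. c x z = c y w} = m * d" by simp
next
  fix x y assume X: "x \<in> \<Omega>" "y \<in> \<Omega>" "x \<noteq> y"
  let ?A = "\<lambda>i. {z \<in> \<Omega>. r x z = r ((s ^^ i) y) ((s ^^ i) z)}"
  have "?A i \<inter> ?A j = {}" if "i < m" "j < m" "i \<noteq> j" for i j
  proof -
    have "z \<notin> ?A i \<inter> ?A j" for z
    proof
      assume z: "z \<in> ?A i \<inter> ?A j"
      then have "z = y" using iter_moves[OF X(2), of z i j] that by force
      then have "r x y = r y y" using z iter_diag[OF X(2) X(2), of i] by simp
      then show False using diag X by blast
    qed
    then show ?thesis by blast
  qed
  moreover have "{z \<in> \<Omega>. c x z = c y z} = (\<Union>i\<in>{..<m}. ?A i)"
    using c_eq_iff[OF X(1) _ X(2)] by blast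
  ultimately have "card {z \<in> \<Omega>. c x z = c y z} = (\<Sum>i<m. card (?A i))"
    using finite_points by (simp only:) (intro card_UN_disjoint, auto)
  also have "\<dots> = card (?A 0) + (\<Sum>i\<in>{..<m} - {0}. card (?A i))"
    using m_pos by (intro sum.remove) auto
  also have "(\<Sum>i\<in>{..<m} - {0}. card (?A i)) = (\<Sum>i\<in>{..<m} - {0}. d)"
    using X s_moves inj_iter iter_in_points by (intro sum.cong refl card_twisted_colours) auto
  finally have "Suc (card {z \<in> \<Omega>. c x z = c y z}) = d + (m - 1) * d"
    using equal[OF X] m_pos by simp
  also have "\<dots> = m * d" using m_pos by (cases m) auto
  finally show "Suc (card {z \<in> \<Omega>. c x z = c y z}) = m * d" .
qed

end

section \<open>The scheme of a binary field\<close>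

text \<open>The finite field is the set of fixed points of the \<open>m\<close>-fold Frobenius map
  in an ambient field. Its closure properties follow because that map is additive and
  multiplicative.\<close>

locale binary_field =
  fixes F :: "'a::field set" and m :: nat
  assumes char2: "(1::'a) + 1 = 0"
    and F_def: "F = {x. x ^ 2 ^ m = x}"
    and card_F: "card F = 2 ^ m"
    and prime_m: "prime m" and odd_m: "odd m"
begin

section \<open>Arithmetic in characteristic two\<close>

lemma add_self: "x + x = (0::'a)"
proof -
  have "x + x = x * (1 + 1)" by (simp only: distrib_left mult_1_right)
  then show ?thesis by (simp only: char2 mult_zero_right)
qed

lemma add_self_left: "x + (x + y) = (y::'a)"
  by (simp only: add.assoc[symmetric] add_self add_0_left)

lemma numeral_Bit0: "numeral (num.Bit0 n) = (0::'a)"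
  by (simp only: numeral_Bit0 add_self)

lemma numeral_Bit1: "numeral (num.Bit1 n) = (1::'a)"
  by (simp only: numeral.numeral_Bit1 add_self add_0_left)

text \<open>Normalises polynomial identities: after sorting, equal summands cancel and numerals
  become 0 or 1.\<close>

lemmas char2_simps = algebra_simps power2_eq_square add_self add_self_left numeral_Bit0 numeral_Bit1

lemma eq_iff_add_eq_0: "x = y \<longleftrightarrow> x + y = (0::'a)"
  by (metis add_self add_self_left add_0_right)

lemma square_add: "(x + y)\<^sup>2 = x\<^sup>2 + (y::'a)\<^sup>2"
  by (simp add: char2_simps)

lemma power_2_power_add: "(x + y) ^ 2 ^ i = x ^ 2 ^ i + (y::'a) ^ 2 ^ i"
  by (induction i) (simp_all add: power_mult square_add mult.commute[of 2])

lemma m_pos: "0 < m"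
  using odd_m by (rule odd_pos)

lemma finite_F: "finite F"
  using card_F by (simp add: card_ge_0_finite)

lemma zero_in_F: "0 \<in> F" and one_in_F: "1 \<in> F"
  by (simp_all add: F_def)

lemma add_in_F: "x \<in> F \<Longrightarrow> y \<in> F \<Longrightarrow> x + y \<in> F"
  by (simp add: F_def power_2_power_add)

lemma mult_in_F: "x \<in> F \<Longrightarrow> y \<in> F \<Longrightarrow> x * y \<in> F"
  by (simp add: F_def power_mult_distrib)

lemma inverse_in_F: "x \<in> F \<Longrightarrow> inverse x \<in> F"
  by (simp add: F_def power_inverse)

lemma divide_in_F: "x \<in> F \<Longrightarrow> y \<in> F \<Longrightarrow> x / y \<in> F"
  by (simp add: divide_inverse mult_in_F inverse_in_F)

lemma power_in_F: "x \<in> F \<Longrightarrow> x ^ n \<in> F"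
  by (induction n) (simp_all add: one_in_F mult_in_F)

lemmas F_closed = zero_in_F one_in_F add_in_F mult_in_F inverse_in_F divide_in_F power_in_F

text \<open>Squaring \<open>m\<close> times is the identity on \<open>F\<close>, so squaring
  \<open>m - 1\<close> times gives a square root.\<close>

lemma ex_sqrt:
  assumes "x \<in> F"
  obtains y where "y \<in> F" "y\<^sup>2 = x"
proof
  show "x ^ 2 ^ (m - 1) \<in> F" using assms by (rule power_in_F)
  have "(x ^ 2 ^ (m - 1))\<^sup>2 = x ^ 2 ^ m"
    using m_pos by (cases m) (simp_all add: power_mult[symmetric] mult.commute)
  then show "(x ^ 2 ^ (m - 1))\<^sup>2 = x" using assms by (simp add: F_def)
qed

section \<open>The image of the Artin-Schreier map, that is, the elements of absolute trace
  0\<close>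

definition T :: "'a set" where "T = (\<lambda>y. y\<^sup>2 + y) ` F"

lemma T_subset: "T \<subseteq> F"
  by (auto simp: T_def F_closed)

lemma in_T: "y \<in> F \<Longrightarrow> y\<^sup>2 + y \<in> T"
  by (simp add: T_def)

lemma zero_in_T: "0 \<in> T"
  using in_T[OF zero_in_F] by simp

lemma add_in_T:
  assumes "x \<in> T" "y \<in> T"
  shows "x + y \<in> T"
proof -
  obtain a b where "a \<in> F" "x = a\<^sup>2 + a" "b \<in> F" "y = b\<^sup>2 + b"
    using assms by (auto simp: T_def)
  then have "x + y = (a + b)\<^sup>2 + (a + b)" "a + b \<in> F"
    by (simp_all add: square_add F_closed)
  then show ?thesis using in_T by simp
qed

lemma add_in_T_cancel: "x \<in> T \<Longrightarrow> x + y \<in> T \<longleftrightarrow> y \<in> T"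
  by (metis add_in_T add_self_left)

text \<open>A solution of \<open>y\<^sup>2 + y = 1\<close> satisfies \<open>y ^ 4 = y\<close>. As
  \<open>m\<close> is odd, its \<open>m\<close>-fold Frobenius image is then
  \<open>y\<^sup>2 = y + 1\<close>, so \<open>y\<close> is not in \<open>F\<close>.\<close>

lemma one_notin_T: "1 \<notin> T"
proof
  assume "1 \<in> T"
  then obtain y where y: "y \<in> F" "y\<^sup>2 + y = 1" by (auto simp: T_def)
  then have y2: "y\<^sup>2 = y + 1" by (metis add_self_left add.commute)
  then have "(y\<^sup>2)\<^sup>2 = y" by (simp add: square_add add_self add.assoc)
  then have y4: "y ^ 4 = y" by (simp flip: power_mult)
  have "y ^ 4 ^ k = y" for k
    by (induction k) (simp_all add: power_mult y4)
  moreover obtain k where "m = 2 * k + 1" using odd_m by (elim oddE)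
  then have "(2::nat) ^ m = 4 ^ k * 2" by (simp add: power_mult)
  ultimately have "y ^ 2 ^ m = y + 1" by (simp add: power_mult y2)
  then show False using y by (simp add: F_def)
qed

text \<open>The map \<open>y\<^sup>2 + y\<close> is two-to-one: its fibres are the sets
  \<open>{a, a + 1}\<close>.\<close>

lemma card_T: "2 * card T = card F"
proof -
  have "card {y \<in> F. t = y\<^sup>2 + y} = 2" if t: "t \<in> T" for t
  proof -
    obtain a where a: "a \<in> F" "t = a\<^sup>2 + a" using t unfolding T_def by blast
    have "t = y\<^sup>2 + y \<longleftrightarrow> y = a \<or> y = a + 1" for y
    proof -
      have "t + (y\<^sup>2 + y) = (a + y) * (a + y + 1)" by (simp add: a char2_simps)
      then have "t = y\<^sup>2 + y \<longleftrightarrow> a + y = 0 \<or> a + y + 1 = 0"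
        by (simp only: eq_iff_add_eq_0[of t] mult_eq_0_iff)
      also have "\<dots> \<longleftrightarrow> y = a \<or> y = a + 1"
        by (metis add_self add_self_left add.commute add.left_commute add_0_right)
      finally show ?thesis .
    qed
    then have "{y \<in> F. t = y\<^sup>2 + y} = {a, a + 1}"
      using a by (auto simp: F_closed)
    then show ?thesis by simp
  qed
  then have "2 * card T = (\<Sum>t\<in>T. card {y \<in> F. t = y\<^sup>2 + y})"
    by simp
  also have "\<dots> = (\<Sum>y\<in>F. card {t \<in> T. t = y\<^sup>2 + y})"
    using card_pairs[of T F "\<lambda>t y. t = y\<^sup>2 + y"] finite_F finite_subset[OF T_subset finite_F] by simp
  also have "\<dots> = (\<Sum>y\<in>F. 1)"
  proof (rule sum.cong[OF refl])
    fix y assume "y \<in> F"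
    then have "{t \<in> T. t = y\<^sup>2 + y} = {y\<^sup>2 + y}" using in_T by auto
    then show "card {t \<in> T. t = y\<^sup>2 + y} = 1" by simp
  qed
  finally show ?thesis by simp
qed

lemma card_F_minus_T: "2 * card (F - T) = card F"
  using card_T card_mono[OF finite_F T_subset] finite_F T_subset
  by (simp add: card_Diff_subset finite_subset)

text \<open>\<open>T\<close> has index 2: the translate of \<open>T\<close> by \<open>x\<close>
  avoids \<open>T\<close>, and by its size it fills the complement.\<close>

lemma add_notin_T:
  assumes "x \<in> F" "y \<in> F" "x \<notin> T" "y \<notin> T"
  shows "x + y \<in> T"
proof -
  have "(+) x ` T \<subseteq> F - T"
    using assms T_subset add_in_T_cancel by (auto simp: F_closed subset_iff add.commute[of x])
  moreover have "card ((+) x ` T) = card T"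
    by (intro card_image) auto
  ultimately have "(+) x ` T = F - T"
    using card_T card_F_minus_T finite_F by (intro card_subset_eq) auto
  then have "y \<in> (+) x ` T" using assms by blast
  then show ?thesis by (auto simp: add_self_left)
qed

lemma add_in_T_iff:
  "x \<in> F \<Longrightarrow> y \<in> F \<Longrightarrow> x + y \<in> T \<longleftrightarrow> (x \<in> T \<longleftrightarrow> y \<in> T)"
  using add_in_T_cancel[of x y] add_in_T_cancel[of y x] add_notin_T[of x y] by (auto simp: add.commute)

lemma power2_in_T_iff: "x \<in> F \<Longrightarrow> x\<^sup>2 \<in> T \<longleftrightarrow> x \<in> T"
  using add_in_T_iff[of "x\<^sup>2" x] in_T[of x] by (simp add: F_closed)

section \<open>The points and their colouring\<close>

definition \<Omega> :: "('a \<times> 'a) set" where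
  "\<Omega> = {(a, c). a \<in> F \<and> c \<in> F \<and> a * c \<notin> T}"

definition r :: "'a \<times> 'a \<Rightarrow> 'a \<times> 'a \<Rightarrow> 'a" where
  "r = (\<lambda>(a, c) (a', c'). (a * c' + c * a')\<^sup>2 + (a + a') * (c + c'))"

text \<open>For each nonzero \<open>a\<close>, multiplication by \<open>a\<close> matches the
  admissible \<open>c\<close> with \<open>F - T\<close>; \<open>a = 0\<close> admits none as 0 is in
  \<open>T\<close>.\<close>

lemma card_points: "2 * card \<Omega> = 2 ^ m * (2 ^ m - 1)"
proof -
  have "\<Omega> = (SIGMA a:F. {c \<in> F. a * c \<notin> T})"
    by (auto simp: \<Omega>_def)
  then have "card \<Omega> = (\<Sum>a\<in>F. card {c \<in> F. a * c \<notin> T})"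
    using finite_F by simp
  also have "\<dots> = (\<Sum>a\<in>F - {0}. card {c \<in> F. a * c \<notin> T})"
    using finite_F by (intro sum.mono_neutral_right) (auto simp: zero_in_T)
  also have "\<dots> = (\<Sum>a\<in>F - {0}. card (F - T))"
  proof (rule sum.cong[OF refl])
    fix a assume a: "a \<in> F - {0}"
    have "bij_betw ((*) a) {c \<in> F. a * c \<notin> T} (F - T)"
      by (rule bij_betw_byWitness[of _ "\<lambda>x. x / a"]) (use a in \<open>auto simp: F_closed\<close>)
    then show "card {c \<in> F. a * c \<notin> T} = card (F - T)"
      by (rule bij_betw_same_card)
  qed
  also have "\<dots> = (2 ^ m - 1) * card (F - T)"
    using finite_F zero_in_F card_F by simp
  finally show ?thesis using card_F_minus_T card_F by simp
qed

text \<open>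
  For a point \<open>(a, c)\<close>, this says that the binary quadratic form
  \<open>(d, e) \<mapsto> (a e + c d)\<^sup>2 + d e\<close> is anisotropic.
\<close>

lemma anisotropic:
  assumes X: "(a, c) \<in> \<Omega>" and de: "d \<in> F" "e \<in> F" and 0: "(a * e + c * d)\<^sup>2 = d * e"
  shows "d = 0 \<and> e = 0"
proof -
  have ac: "a \<in> F" "c \<in> F" "a * c \<notin> T" using X by (auto simp: \<Omega>_def)
  then have "a \<noteq> 0" "c \<noteq> 0" using zero_in_T by auto
  show ?thesis
  proof (cases "d = 0")
    case True
    then show ?thesis using 0 \<open>a \<noteq> 0\<close> by simp
  next
    case False
    \<comment> \<open>In terms of \<open>s\<close> the equation reads
      \<open>e = d * s\<^sup>2\<close>, and the definition of \<open>s\<close> becomes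
      \<open>s = a * s\<^sup>2 + c\<close>. Multiplying by \<open>a\<close> puts
      \<open>a * c\<close> into \<open>T\<close>, a contradiction.\<close>
    define s where "s = (a * e + c * d) / d"
    have "s \<in> F" using ac de by (simp add: s_def F_closed)
    have "e = d * s\<^sup>2"
      using 0 False by (simp add: s_def power_divide) (simp add: power2_eq_square)
    moreover have "d * s = a * e + c * d" using False by (simp add: s_def)
    ultimately have "d * s = d * (a * s\<^sup>2 + c)" by (simp add: algebra_simps)
    then have "s = a * s\<^sup>2 + c" using False by simp
    then have "a * c = (a * s)\<^sup>2 + a * s"
      by (metis (no_types, opaque_lifting) add_self_left distrib_left mult.assoc mult.commute power2_eq_square add.commute)
    then show ?thesis using in_T[of "a * s"] ac \<open>s \<in> F\<close> by (simp add: F_closed)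
  qed
qed

lemma r_sym: "r x y = r y x"
  by (simp add: r_def split_beta algebra_simps)

lemma r_translate: "r (a, c) (a + d, c + e) = (a * e + c * d)\<^sup>2 + d * e"
  by (simp add: r_def char2_simps)

lemma r_expand:
  "r (a, c) (a', c') = ((a * c' + c * a')\<^sup>2 + (a * c' + c * a')) + (a * c + a' * c')"
  by (simp add: r_def char2_simps)

text \<open>Membership in \<Omega> can be read off the colour, because the first bracket in
  \<open>r_expand\<close> has the form \<open>y\<^sup>2 + y\<close> and lies in
  \<open>T\<close>.\<close>

lemma in_points_iff:
  assumes "(a, c) \<in> \<Omega>" "a' \<in> F" "c' \<in> F"
  shows "(a', c') \<in> \<Omega> \<longleftrightarrow> r (a, c) (a', c') \<in> T"
proof -
  have "r (a, c) (a', c') \<in> T \<longleftrightarrow> a * c + a' * c' \<in> T"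
    unfolding r_expand using assms by (intro add_in_T_cancel in_T) (auto simp: \<Omega>_def F_closed)
  also have "\<dots> \<longleftrightarrow> (a', c') \<in> \<Omega>"
    using assms add_in_T_iff[of "a * c" "a' * c'"] by (auto simp: \<Omega>_def F_closed)
  finally show ?thesis ..
qed

lemma r_in_T: "x \<in> \<Omega> \<Longrightarrow> y \<in> \<Omega> \<Longrightarrow> r x y \<in> T"
  using in_points_iff by (auto simp: \<Omega>_def)

lemma r_eq_0_iff:
  assumes "x \<in> \<Omega>" "y \<in> \<Omega>"
  shows "r x y = 0 \<longleftrightarrow> x = y"
proof
  obtain a c a' c' where xy: "x = (a, c)" "y = (a', c')" by fastforce
  have "r x y = (a * (c + c') + c * (a + a'))\<^sup>2 + (a + a') * (c + c')"
    using r_translate[of a c "a + a'" "c + c'"] by (simp add: xy add_self_left)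
  moreover assume "r x y = 0"
  ultimately have "(a * (c + c') + c * (a + a'))\<^sup>2 = (a + a') * (c + c')"
    using eq_iff_add_eq_0 by metis
  then have "a + a' = 0 \<and> c + c' = 0"
    using assms by (intro anisotropic[of a c]) (auto simp: xy \<Omega>_def F_closed)
  then show "x = y"
    using eq_iff_add_eq_0[of a a'] eq_iff_add_eq_0[of c c'] by (simp add: xy)
next
  show "r x y = 0" if "x = y"
    using that by (simp add: r_def split_beta add_self mult.commute)
qed

section \<open>Affine transvections and transitivity\<close>

text \<open>
  The parameter \<open>\<sigma>\<close> stands for the square root of \<open>e * f\<close>.
\<close>

definition transvection :: "'a \<Rightarrow> 'a \<Rightarrow> 'a \<Rightarrow> 'a \<times> 'a \<Rightarrow> 'a \<times> 'a" where
  "transvection \<sigma> e f = (\<lambda>(a, c). let l = 1 + \<sigma> + (a * f + c * e) in (a + l * e, c + l * f))"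

text \<open>The product of the coordinates changes by
  \<open>l * w + l\<^sup>2 * \<sigma>\<^sup>2\<close>, and \<open>z\<close> is chosen so that this
  equals \<open>z\<^sup>2 + z\<close>, an element of \<open>T\<close>.\<close>

lemma transvection_in_points:
  assumes "x \<in> \<Omega>" and ef: "\<sigma> \<in> F" "e \<in> F" "f \<in> F" "\<sigma>\<^sup>2 = e * f"
  shows "transvection \<sigma> e f x \<in> \<Omega>"
proof -
  obtain a c where x: "x = (a, c)" "a \<in> F" "c \<in> F" "a * c \<notin> T"
    using assms by (auto simp: \<Omega>_def)
  define w where "w = a * f + c * e"
  define l where "l = 1 + \<sigma> + w"
  define z where "z = w + \<sigma> * w + \<sigma>\<^sup>2"
  have F: "w \<in> F" "l \<in> F" "z \<in> F" by (simp_all add: w_def l_def z_def x ef F_closed)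
  have "(a + l * e) * (c + l * f) = a * c + (l * w + l\<^sup>2 * (e * f))"
    by (simp add: w_def char2_simps)
  also have "l * w + l\<^sup>2 * (e * f) = z\<^sup>2 + z"
    unfolding ef(4)[symmetric] by (simp add: z_def l_def char2_simps)
  finally have "(a + l * e) * (c + l * f) \<notin> T"
    using x in_T[OF F(3)] add_in_T_cancel by (metis add.commute)
  then show ?thesis
    using F x ef by (simp add: x transvection_def Let_def \<Omega>_def F_closed flip: w_def l_def)
qed

text \<open>The polar form changes by \<open>(1 + \<sigma>) * v\<close>, and the product of the
  coordinate differences by the square of the same element. As the polar form enters
  \<open>r\<close> squared, the changes cancel.\<close>

lemma r_transvection:
  assumes "\<sigma>\<^sup>2 = e * f"
  shows "r (transvection \<sigma> e f x) (transvection \<sigma> e f y) = r x y"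
proof -
  obtain a c a' c' where xy: "x = (a, c)" "y = (a', c')" by fastforce
  define w where "w = a * f + c * e"
  define w' where "w' = a' * f + c' * e"
  define l where "l = 1 + \<sigma> + w"
  define l' where "l' = 1 + \<sigma> + w'"
  define v where "v = w + w'"
  have "(a + l * e) * (c' + l' * f) + (c + l * f) * (a' + l' * e) = (a * c' + c * a') + (l' * w + l * w')"
    by (simp add: w_def w'_def char2_simps)
  also have "l' * w + l * w' = (1 + \<sigma>) * v"
    by (simp add: v_def l_def l'_def char2_simps)
  finally have 1: "(a + l * e) * (c' + l' * f) + (c + l * f) * (a' + l' * e) = (a * c' + c * a') + (1 + \<sigma>) * v" .
  have "l + l' = v"
    by (simp add: v_def l_def l'_def char2_simps)
  then have "(a + l * e) + (a' + l' * e) = a + a' + v * e" "(c + l * f) + (c' + l' * f) = c + c' + v * f"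
    by (auto simp: algebra_simps)
  moreover have "(a + a' + v * e) * (c + c' + v * f) = (a + a') * (c + c') + (v * ((a + a') * f + (c + c') * e) + v\<^sup>2 * (e * f))"
    by (simp add: char2_simps)
  moreover have "(a + a') * f + (c + c') * e = v"
    by (simp add: v_def w_def w'_def algebra_simps)
  ultimately have 2: "((a + l * e) + (a' + l' * e)) * ((c + l * f) + (c' + l' * f)) = (a + a') * (c + c') + (v * v + v\<^sup>2 * \<sigma>\<^sup>2)"
    by (simp only: assms)
  have "r (transvection \<sigma> e f x) (transvection \<sigma> e f y)
    = ((a * c' + c * a') + (1 + \<sigma>) * v)\<^sup>2 + ((a + a') * (c + c') + (v * v + v\<^sup>2 * \<sigma>\<^sup>2))"
    using 1 2 by (simp add: r_def transvection_def xy Let_def flip: w_def w'_def l_def l'_def)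
  also have "\<dots> = (a * c' + c * a')\<^sup>2 + (a + a') * (c + c')"
    by (simp add: square_add power_mult_distrib) (simp add: char2_simps)
  finally show ?thesis by (simp add: r_def xy)
qed

text \<open>Take \<open>(e, f)\<close> as \<open>k\<close> times the displacement
  \<open>(d, g)\<close>. Reaching \<open>y\<close> then requires
  \<open>k * (1 + k * \<alpha>) = 1\<close>, which for \<open>z = k * \<alpha>\<close> reads
  \<open>z\<^sup>2 + z = \<alpha>\<close>. This is solvable since
  \<open>\<alpha>\<^sup>2 = r x y\<close> lies in \<open>T\<close> and hence so does
  \<open>\<alpha>\<close>.\<close>

lemma ex_transvection:
  assumes x: "x \<in> \<Omega>" and y: "y \<in> \<Omega>" and ne: "x \<noteq> y"
  shows "\<exists>\<sigma>\<in>F. \<exists>e\<in>F. \<exists>f\<in>F. \<sigma>\<^sup>2 = e * f \<and> transvection \<sigma> e f x = y"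
proof -
  obtain a c a' c' where xy: "x = (a, c)" "y = (a', c')" by fastforce
  define d where "d = a + a'"
  define g where "g = c + c'"
  have y': "a' = a + d" "c' = c + g" by (simp_all add: d_def g_def add_self_left)
  have F: "a \<in> F" "c \<in> F" "d \<in> F" "g \<in> F" using x y by (auto simp: xy \<Omega>_def d_def g_def F_closed)
  obtain \<tau> where \<tau>: "\<tau> \<in> F" "\<tau>\<^sup>2 = d * g" using ex_sqrt[of "d * g"] F by (auto simp: F_closed)
  define \<alpha> where "\<alpha> = \<tau> + (a * g + c * d)"
  have "\<alpha>\<^sup>2 = r x y" by (simp add: \<alpha>_def xy y' r_translate square_add \<tau> add.commute)
  moreover have \<alpha>F: "\<alpha> \<in> F" by (simp add: \<alpha>_def \<tau> F F_closed)
  ultimately have "\<alpha> \<in> T" "\<alpha> \<noteq> 0"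
    using power2_in_T_iff[of \<alpha>] r_in_T[OF x y] r_eq_0_iff[OF x y] ne by auto
  then obtain z where z: "z \<in> F" "\<alpha> = z\<^sup>2 + z" unfolding T_def by blast
  define k where "k = z / \<alpha>"
  have kF: "k \<in> F" using z \<alpha>F by (simp add: k_def F_closed)
  have "k * \<alpha> = z" using \<open>\<alpha> \<noteq> 0\<close> by (simp add: k_def)
  then have "\<alpha> * (k * (1 + k * \<alpha>)) = \<alpha>"
    by (metis z(2) add.commute distrib_left mult.assoc mult.commute mult_1_right power2_eq_square)
  then have kl: "k * (1 + k * \<alpha>) = 1" using \<open>\<alpha> \<noteq> 0\<close> by simp
  have "1 + k * \<tau> + (a * (k * g) + c * (k * d)) = 1 + k * \<alpha>"
    by (simp add: \<alpha>_def algebra_simps)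
  then have "transvection (k * \<tau>) (k * d) (k * g) x = (a + (k * (1 + k * \<alpha>)) * d, c + (k * (1 + k * \<alpha>)) * g)"
    by (simp add: transvection_def xy Let_def mult_ac)
  then have "transvection (k * \<tau>) (k * d) (k * g) x = y"
    by (simp add: kl xy y')
  moreover have "(k * \<tau>)\<^sup>2 = (k * d) * (k * g)"
    by (simp add: power_mult_distrib \<tau>) (simp add: power2_eq_square)
  ultimately show ?thesis using kF \<tau> F F_closed(4) by blast
qed

text \<open>The multiplier \<open>k = 1 / \<alpha>\<close> makes the factor \<open>l\<close> of the
  transvection vanish at \<open>x\<close>; anisotropy gives \<open>\<alpha> \<noteq> 0\<close>.
  Equality of the colours says \<open>\<beta> + \<gamma> = \<alpha>\<^sup>2\<close>, so
  \<open>l\<close> is \<open>\<alpha>\<close> at \<open>y\<close>, which therefore moves by exactly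
  \<open>(d, g)\<close>.\<close>

lemma ex_transvection_fixing:
  assumes x: "x \<in> \<Omega>" and y: "y \<in> \<Omega>" and z: "z \<in> \<Omega>" and ne: "y \<noteq> z" and eq: "r x y = r x z"
  shows "\<exists>\<sigma>\<in>F. \<exists>e\<in>F. \<exists>f\<in>F. \<sigma>\<^sup>2 = e * f \<and> transvection \<sigma> e f x = x \<and> transvection \<sigma> e f y = z"
proof -
  obtain a c b b' z1 z2 where xyz: "x = (a, c)" "y = (b, b')" "z = (z1, z2)" by (metis surj_pair)
  define d where "d = b + z1"
  define g where "g = b' + z2"
  have z': "z1 = b + d" "z2 = b' + g" by (simp_all add: d_def g_def add_self_left)
  have F: "a \<in> F" "c \<in> F" "b \<in> F" "b' \<in> F" "d \<in> F" "g \<in> F"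
    using x y z by (auto simp: xyz \<Omega>_def d_def g_def F_closed)
  obtain \<tau> where \<tau>: "\<tau> \<in> F" "\<tau>\<^sup>2 = d * g" using ex_sqrt[of "d * g"] F by (auto simp: F_closed)
  define \<beta> where "\<beta> = a * g + c * d"
  define \<gamma> where "\<gamma> = b * g + b' * d"
  define \<alpha> where "\<alpha> = \<tau> + \<beta>"
  have \<alpha>2: "\<alpha>\<^sup>2 = \<beta>\<^sup>2 + d * g" by (simp add: \<alpha>_def square_add \<tau> add.commute)
  have \<alpha>F: "\<alpha> \<in> F" by (simp add: \<alpha>_def \<beta>_def \<tau> F F_closed)
  have "\<alpha> \<noteq> 0"
  proof
    assume "\<alpha> = 0"
    then have "\<beta>\<^sup>2 = d * g" using \<alpha>2 by (simp add: eq_iff_add_eq_0[of "\<beta>\<^sup>2"])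
    then have "d = 0 \<and> g = 0"
      using anisotropic[of a c d g] x F by (simp add: xyz \<beta>_def)
    then show False using ne by (simp add: xyz z')
  qed
  have "r x y + r x z = (\<beta>\<^sup>2 + d * g) + (\<beta> + \<gamma>)"
    by (simp add: r_def xyz z' \<beta>_def \<gamma>_def char2_simps)
  then have \<beta>\<gamma>: "\<beta> + \<gamma> = \<alpha>\<^sup>2"
    using eq by (simp add: add_self \<alpha>2 eq_iff_add_eq_0[of "\<beta> + \<gamma>"] add_ac)
  define k where "k = 1 / \<alpha>"
  have kF: "k \<in> F" using \<alpha>F by (simp add: k_def F_closed)
  have k\<alpha>: "k * \<alpha> = 1" using \<open>\<alpha> \<noteq> 0\<close> by (simp add: k_def)
  have "1 + k * \<tau> + (a * (k * g) + c * (k * d)) = 1 + k * \<alpha>"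
    by (simp add: \<alpha>_def \<beta>_def algebra_simps)
  then have lx: "1 + k * \<tau> + (a * (k * g) + c * (k * d)) = 0"
    by (simp add: k\<alpha> add_self)
  have "1 + k * \<tau> + (b * (k * g) + b' * (k * d)) = (1 + k * \<alpha>) + k * (\<beta> + \<gamma>)"
    by (simp add: \<alpha>_def \<gamma>_def char2_simps)
  also have "\<dots> = (k * \<alpha>) * \<alpha>"
    by (simp add: \<beta>\<gamma> k\<alpha> add_self power2_eq_square flip: mult.assoc)
  finally have ly: "1 + k * \<tau> + (b * (k * g) + b' * (k * d)) = \<alpha>"
    by (simp add: k\<alpha>)
  have "transvection (k * \<tau>) (k * d) (k * g) x = x"
    by (simp add: transvection_def xyz Let_def lx)
  moreover have "transvection (k * \<tau>) (k * d) (k * g) y = (b + (k * \<alpha>) * d, b' + (k * \<alpha>) * g)"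
    by (simp only: transvection_def xyz Let_def prod.case ly) (simp add: mult_ac)
  then have "transvection (k * \<tau>) (k * d) (k * g) y = z"
    by (simp add: k\<alpha> xyz z')
  moreover have "(k * \<tau>)\<^sup>2 = (k * d) * (k * g)"
    by (simp add: power_mult_distrib \<tau>) (simp add: power2_eq_square)
  ultimately show ?thesis using kF \<tau> F F_closed(4) by blast
qed

lemma r_transitive:
  assumes X: "x \<in> \<Omega>" "y \<in> \<Omega>" "x' \<in> \<Omega>" "y' \<in> \<Omega>" and eq: "r x y = r x' y'"
  shows "\<exists>g. g ` \<Omega> \<subseteq> \<Omega> \<and> (\<forall>u\<in>\<Omega>. \<forall>v\<in>\<Omega>. r (g u) (g v) = r u v) \<and> g x = x' \<and> g y = y'"
proof -
  obtain g where g: "\<And>u. u \<in> \<Omega> \<Longrightarrow> g u \<in> \<Omega>" "\<And>u v. r (g u) (g v) = r u v" "g x = x'"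
  proof (cases "x = x'")
    case True
    then show ?thesis by (intro that[of id]) simp_all
  next
    case False
    then show ?thesis
      using ex_transvection[OF X(1,3)] transvection_in_points r_transvection that by metis
  qed
  obtain h where h: "\<And>u. u \<in> \<Omega> \<Longrightarrow> h u \<in> \<Omega>" "\<And>u v. r (h u) (h v) = r u v" "h x' = x'" "h (g y) = y'"
  proof (cases "g y = y'")
    case True
    then show ?thesis by (intro that[of id]) simp_all
  next
    case False
    have "r x' (g y) = r x' y'" using g(2)[of x y] g(3) eq by simp
    then show ?thesis
      using ex_transvection_fixing[OF X(3) g(1)[OF X(2)] X(4) False]
        transvection_in_points r_transvection that by metis
  qed
  show ?thesis
    by (intro exI[of _ "h \<circ> g"] conjI ballI image_subsetI) (simp_all add: g h)
qed

section \<open>Valencies and the pseudocyclic condition\<close>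

lemma card_circle:
  assumes x: "(a, c) \<in> \<Omega>" and w: "w \<in> F" "w \<noteq> 0"
  shows "card {(d, e). d \<in> F \<and> e \<in> F \<and> (a * e + c * d)\<^sup>2 + d * e = w} = 2 ^ m + 1"
proof -
  define N where "N = (\<lambda>(d, e). (a * e + c * d)\<^sup>2 + d * e)"
  let ?C = "\<lambda>w. {p \<in> F \<times> F. N p = w}"
  have ac: "a \<in> F" "c \<in> F" using x by (auto simp: \<Omega>_def)
  have N0: "N p = 0 \<longleftrightarrow> p = (0, 0)" if "p \<in> F \<times> F" for p
    using anisotropic[OF x, of "fst p" "snd p"] that eq_iff_add_eq_0
    by (cases p) (auto simp: N_def)
  have NF: "N p \<in> F" if "p \<in> F \<times> F" for p
    using that ac by (auto simp: N_def F_closed)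
  \<comment> \<open>Scaling by a square root of \<open>v\<close> multiplies \<open>N\<close> by
    \<open>v\<close>, so all nonzero values are taken equally often. The
    \<open>q\<^sup>2 - 1\<close> nonzero vectors are thus shared evenly by \<open>q - 1\<close>
    values.\<close>
  have card: "card (?C v) = card (?C 1)" if v: "v \<in> F - {0}" for v
  proof -
    obtain s where s: "s \<in> F" "s\<^sup>2 = v" using v ex_sqrt[of v] by blast
    then have "s \<noteq> 0" using v by auto
    have N: "N (u * d, u * e) = u\<^sup>2 * N (d, e)" for u d e
      by (simp add: N_def power2_eq_square algebra_simps)
    have "bij_betw (\<lambda>(d, e). (s * d, s * e)) (?C 1) (?C v)"
    proof (rule bij_betw_byWitness[of _ "\<lambda>(d, e). (inverse s * d, inverse s * e)"])
      show "(\<lambda>(d, e). (s * d, s * e)) ` ?C 1 \<subseteq> ?C v"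
        using s by (auto simp: N F_closed)
      have "(inverse s)\<^sup>2 * v = 1"
        using s(2) v by (auto simp: power_inverse)
      then show "(\<lambda>(d, e). (inverse s * d, inverse s * e)) ` ?C v \<subseteq> ?C 1"
        using s(1) N[of "inverse s"] mult_in_F[OF inverse_in_F] by (simp add: image_subset_iff split_beta)
    qed (use \<open>s \<noteq> 0\<close> in \<open>auto simp flip: mult.assoc\<close>)
    from bij_betw_same_card[OF this] show ?thesis ..
  qed
  have "(2 ^ m - 1) * card (?C 1) = (\<Sum>v\<in>F - {0}. card (?C v))"
    using card finite_F card_F zero_in_F by simp
  also have "\<dots> = (\<Sum>p\<in>F \<times> F. card {v \<in> F - {0}. N p = v})"
    using card_pairs[of "F - {0}" "F \<times> F" "\<lambda>v p. N p = v"] finite_F by simp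
  also have "\<dots> = (\<Sum>p\<in>F \<times> F. if p = (0, 0) then 0 else 1)"
  proof (rule sum.cong[OF refl])
    fix p assume p: "p \<in> F \<times> F"
    have "{v \<in> F - {0}. N p = v} = (if p = (0, 0) then {} else {N p})"
      using N0[OF p] NF[OF p] by auto
    then show "card {v \<in> F - {0}. N p = v} = (if p = (0, 0) then 0 else 1)"
      by simp
  qed
  also have "\<dots> = card (F \<times> F - {(0, 0)})"
    using finite_F by (simp add: sum.If_cases Diff_eq Int_commute)
  also have "\<dots> = 2 ^ m * 2 ^ m - 1"
    using finite_F zero_in_F card_F by (simp add: card_cartesian_product)
  also have "\<dots> = (2 ^ m - 1) * (2 ^ m + 1)"
    by (simp add: algebra_simps)
  finally have "card (?C 1) = 2 ^ m + 1"
    using one_less_power[of "2::nat" m] m_pos by (simp only: mult_cancel1) simp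
  moreover have "{(d, e). d \<in> F \<and> e \<in> F \<and> (a * e + c * d)\<^sup>2 + d * e = w} = ?C w"
    by (auto simp: N_def)
  ultimately show ?thesis using card[of w] w by simp
qed

text \<open>Translation by \<open>x\<close> carries the circle to the relation class; its image
  stays in \<Omega> by \<open>in_points_iff\<close>, as \<open>w\<close> is in
  \<open>T\<close>.\<close>

lemma card_relation:
  assumes x: "x \<in> \<Omega>" and w: "w \<in> T" "w \<noteq> 0"
  shows "card {z \<in> \<Omega>. r x z = w} = 2 ^ m + 1"
proof -
  obtain a c where ac: "x = (a, c)" "a \<in> F" "c \<in> F" using x by (auto simp: \<Omega>_def)
  have "bij_betw (\<lambda>(d, e). (a + d, c + e))
    {(d, e). d \<in> F \<and> e \<in> F \<and> (a * e + c * d)\<^sup>2 + d * e = w} {z \<in> \<Omega>. r x z = w}"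
  proof (rule bij_betw_byWitness[of _ "\<lambda>(d, e). (a + d, c + e)"])
    have "(a + d, c + e) \<in> \<Omega>" if "d \<in> F" "e \<in> F" "(a * e + c * d)\<^sup>2 + d * e = w" for d e
      using in_points_iff[of a c "a + d" "c + e"] x w that ac by (simp add: r_translate F_closed)
    then show "(\<lambda>(d, e). (a + d, c + e)) ` {(d, e). d \<in> F \<and> e \<in> F \<and> (a * e + c * d)\<^sup>2 + d * e = w}
        \<subseteq> {z \<in> \<Omega>. r x z = w}"
      by (auto simp: r_translate ac)
    have "(a * (c + z2) + c * (a + z1))\<^sup>2 + (a + z1) * (c + z2) = r x (z1, z2)" for z1 z2
      using r_translate[of a c "a + z1" "c + z2"] by (simp add: ac add_self_left)
    then show "(\<lambda>(d, e). (a + d, c + e)) ` {z \<in> \<Omega>. r x z = w}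
        \<subseteq> {(d, e). d \<in> F \<and> e \<in> F \<and> (a * e + c * d)\<^sup>2 + d * e = w}"
      using ac by (auto simp: F_closed \<Omega>_def)
  qed (auto simp: add_self_left)
  from bij_betw_same_card[OF this] show ?thesis
    using card_circle[of a c w] x w T_subset ac by (simp add: subset_iff)
qed

lemma card_line:
  assumes "d \<in> F" "g \<in> F" "(d, g) \<noteq> (0, 0)" "v \<in> F"
  shows "card {(a, c). a \<in> F \<and> c \<in> F \<and> d * c + g * a = v} = 2 ^ m"
proof (cases "d = 0")
  case True
  then have "g \<noteq> 0" using assms by simp
  have "{(a, c). a \<in> F \<and> c \<in> F \<and> d * c + g * a = v} = (\<lambda>c. (v / g, c)) ` F"
    using True \<open>g \<noteq> 0\<close> assms by (auto simp: F_closed field_simps image_iff)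
  then show ?thesis
    using card_F by (simp add: card_image inj_on_def)
next
  case False
  have "d * c + g * a = v \<longleftrightarrow> c = (v + g * a) / d" for a c
  proof -
    have "d * c + g * a = v \<longleftrightarrow> d * c = v + g * a"
      by (metis add_self_left add.commute)
    then show ?thesis using False by (simp add: field_simps)
  qed
  then have "{(a, c). a \<in> F \<and> c \<in> F \<and> d * c + g * a = v} = (\<lambda>a. (a, (v + g * a) / d)) ` F"
    using assms by (auto simp: F_closed)
  then show ?thesis
    using card_F by (simp add: card_image inj_on_def)
qed

text \<open>
  Translation by a suitable multiple of \<open>(d, g)\<close> preserves the line and changes \<open>a * c\<close> by an
  element outside \<open>T\<close>, so that exactly half of the points of the line belong to \<open>\<Omega>\<close>.
\<close>

lemma card_points_on_line:
  assumes dg: "d \<in> F" "g \<in> F" "(d, g) \<noteq> (0, 0)" and v: "v \<in> F" "v\<^sup>2 \<noteq> d * g"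
  shows "2 * card {(a, c). (a, c) \<in> \<Omega> \<and> d * c + g * a = v} = 2 ^ m"
proof -
  let ?L = "{(a, c). a \<in> F \<and> c \<in> F \<and> d * c + g * a = v}"
  let ?P = "{(a, c). (a, c) \<in> \<Omega> \<and> d * c + g * a = v}"
  obtain \<tau> where \<tau>: "\<tau> \<in> F" "\<tau>\<^sup>2 = d * g" using ex_sqrt[of "d * g"] dg by (auto simp: F_closed)
  \<comment> \<open>This \<open>s\<close> makes the increment of \<open>a * c\<close> equal to 1
    plus the element \<open>(s * \<tau>)\<^sup>2 + s * \<tau>\<close> of \<open>T\<close>. The
    denominator is nonzero because \<open>v\<^sup>2 \<noteq> d * g\<close>.\<close>
  define s where "s = 1 / (v + \<tau>)"
  have sF: "s \<in> F" using v \<tau> by (simp add: s_def F_closed)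
  have "v + \<tau> \<noteq> 0" using v \<tau> by (metis eq_iff_add_eq_0)
  then have "s * (v + \<tau>) = 1" by (simp add: s_def)
  have *: "(a + s * d) * (c + s * g) = a * c + (1 + ((s * \<tau>)\<^sup>2 + s * \<tau>))" if "d * c + g * a = v" for a c
  proof -
    have "(a + s * d) * (c + s * g) = a * c + (s * (d * c + g * a) + s\<^sup>2 * (d * g))"
      by (simp add: power2_eq_square algebra_simps)
    also have "s * (d * c + g * a) + s\<^sup>2 * (d * g) = s * (v + \<tau>) + ((s * \<tau>)\<^sup>2 + s * \<tau>)"
      unfolding that \<tau>(2)[symmetric] by (simp add: char2_simps)
    finally show ?thesis by (simp only: \<open>s * (v + \<tau>) = 1\<close>)
  qed
  have flip: "(a + s * d) * (c + s * g) \<in> T \<longleftrightarrow> a * c \<notin> T" if "d * c + g * a = v" "a \<in> F" "c \<in> F" for a c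
  proof -
    have "1 + ((s * \<tau>)\<^sup>2 + s * \<tau>) \<notin> T"
      using one_notin_T in_T[of "s * \<tau>"] sF \<tau> add_in_T_cancel[of "(s * \<tau>)\<^sup>2 + s * \<tau>" 1]
      by (simp add: F_closed add.commute)
    then show ?thesis
      unfolding *[OF that(1)] using sF \<tau> that by (subst add_in_T_iff) (auto simp: F_closed)
  qed
  have line: "d * (c + s * g) + g * (a + s * d) = d * c + g * a" for a c
    by (simp add: char2_simps)
  have "bij_betw (\<lambda>(a, c). (a + s * d, c + s * g)) ?P (?L - ?P)"
  proof (rule bij_betw_byWitness[of _ "\<lambda>(a, c). (a + s * d, c + s * g)"])
    show "(\<lambda>(a, c). (a + s * d, c + s * g)) ` ?P \<subseteq> ?L - ?P"
      using flip line sF dg by (auto simp: \<Omega>_def F_closed)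
    show "(\<lambda>(a, c). (a + s * d, c + s * g)) ` (?L - ?P) \<subseteq> ?P"
      using flip line sF dg by (auto simp: \<Omega>_def F_closed)
  qed (auto simp: add_self add.assoc)
  then have "card ?P = card (?L - ?P)" by (rule bij_betw_same_card)
  moreover have "finite ?L"
    using finite_F by (rule_tac finite_subset[of _ "F \<times> F"]) auto
  moreover have "?P \<subseteq> ?L" by (auto simp: \<Omega>_def)
  ultimately have "2 * card ?P = card ?L"
    using card_Diff_subset[of ?P ?L] card_mono[of ?L ?P] finite_subset[of ?P ?L] by linarith
  then show ?thesis using card_line[OF dg v(1)] by simp
qed

text \<open>The sum of the two colours factors as \<open>(v + w) * (v + w + 1)\<close>, where
  \<open>v\<close> is linear in the point. Its zeros form two parallel lines, each of which has
  \<open>q / 2\<close> points in \<Omega>.\<close>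

lemma card_equal_relation:
  assumes x: "x \<in> \<Omega>" and y: "y \<in> \<Omega>" and ne: "x \<noteq> y"
  shows "card {z \<in> \<Omega>. r x z = r y z} = 2 ^ m"
proof -
  obtain a c a' c' where xy: "x = (a, c)" "y = (a', c')" by fastforce
  define d where "d = a + a'"
  define g where "g = c + c'"
  have y': "a' = a + d" "c' = c + g" by (simp_all add: d_def g_def add_self_left)
  have F: "a \<in> F" "c \<in> F" "a' \<in> F" "c' \<in> F" "d \<in> F" "g \<in> F"
    using x y by (auto simp: xy \<Omega>_def d_def g_def F_closed)
  have dg: "(d, g) \<noteq> (0, 0)" using ne by (auto simp: xy y')
  have "a * c + a' * c' \<in> T"
    using x y F by (subst add_in_T_iff) (auto simp: xy \<Omega>_def F_closed)
  then obtain w where w: "w \<in> F" "a * c + a' * c' = w\<^sup>2 + w" unfolding T_def by blast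
  let ?P = "\<lambda>v. {(z, z'). (z, z') \<in> \<Omega> \<and> d * z' + g * z = v}"
  have "r x (z, z') = r y (z, z') \<longleftrightarrow> d * z' + g * z = w \<or> d * z' + g * z = w + 1" for z z'
  proof -
    let ?v = "d * z' + g * z"
    have "r x (z, z') + r y (z, z') = (?v\<^sup>2 + ?v) + (a * c + a' * c')"
      by (simp add: r_def xy y' char2_simps)
    also have "\<dots> = (?v + w) * (?v + w + 1)"
      unfolding w by (simp add: char2_simps)
    finally have "r x (z, z') = r y (z, z') \<longleftrightarrow> ?v + w = 0 \<or> ?v + w + 1 = 0"
      by (simp only: eq_iff_add_eq_0[of "r x (z, z')"] mult_eq_0_iff)
    then show ?thesis
      by (simp only: eq_iff_add_eq_0[of ?v w] eq_iff_add_eq_0[of ?v "w + 1"] add.assoc)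
  qed
  then have eq: "{z \<in> \<Omega>. r x z = r y z} = ?P w \<union> ?P (w + 1)"
    by auto
  have r: "r x y = (a * g + c * d)\<^sup>2 + d * g"
    by (simp add: xy y' r_translate)
  \<comment> \<open>\<open>card_points_on_line\<close> excludes \<open>v\<^sup>2 = d * g\<close>. On
    these two lines that would force \<open>v = a * g + c * d\<close> and hence
    \<open>r x y = 0\<close>.\<close>
  have neq: "v\<^sup>2 \<noteq> d * g" if v: "v\<^sup>2 + v = w\<^sup>2 + w" for v
  proof
    assume "v\<^sup>2 = d * g"
    moreover have "v\<^sup>2 + v = d * g + (a * g + c * d)"
      unfolding v w(2)[symmetric] by (simp add: y' char2_simps)
    ultimately have "v = a * g + c * d" by simp
    then have "r x y = 0" using \<open>v\<^sup>2 = d * g\<close> by (simp add: r add_self)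
    then show False using r_eq_0_iff x y ne by simp
  qed
  have fin: "finite (?P v)" for v
    using finite_F by (rule_tac finite_subset[of _ "F \<times> F"]) (auto simp: \<Omega>_def)
  have "2 * card (?P w) = 2 ^ m"
    using F dg w neq[of w] by (intro card_points_on_line) auto
  moreover have "2 * card (?P (w + 1)) = 2 ^ m"
  proof (rule card_points_on_line[OF F(5,6) dg])
    have "(w + 1)\<^sup>2 + (w + 1) = w\<^sup>2 + w" by (simp add: char2_simps)
    then show "(w + 1)\<^sup>2 \<noteq> d * g" by (rule neq)
  qed (use w F_closed in auto)
  moreover have "card (?P w \<union> ?P (w + 1)) = card (?P w) + card (?P (w + 1))"
    by (intro card_Un_disjoint fin) auto
  ultimately show ?thesis unfolding eq by linarith
qed

section \<open>The Frobenius map on points and colours\<close>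

definition frob :: "'a \<times> 'a \<Rightarrow> 'a \<times> 'a" where
  "frob = (\<lambda>(a, c). (a\<^sup>2, c\<^sup>2))"

lemma frob_power: "(frob ^^ i) (a, c) = (a ^ 2 ^ i, c ^ 2 ^ i)"
  by (induction i) (simp_all add: frob_def power_mult[symmetric] mult.commute)

lemma r_frob: "r (frob x) (frob y) = (r x y)\<^sup>2"
  by (simp add: r_def frob_def split_beta square_add power_mult_distrib)

lemma r_frob_power: "r ((frob ^^ i) x) ((frob ^^ i) y) = r x y ^ 2 ^ i"
  by (induction i) (simp_all add: r_frob power_mult[symmetric] mult.commute)

text \<open>As \<open>i\<close> is coprime to the prime \<open>m\<close>, some multiple of
  \<open>i\<close> is 1 modulo \<open>m\<close>. Hence the Frobenius map itself fixes
  \<open>x\<close>, that is, \<open>x\<^sup>2 = x\<close>.\<close>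

lemma fixed_by_Frobenius_power:
  assumes x: "x \<in> F" and i: "0 < i" "i < m" "x ^ 2 ^ i = x"
  shows "x = 0 \<or> x = 1"
proof -
  have "coprime i m"
    using prime_m i by (metis coprime_commute prime_imp_coprime nat_dvd_not_less)
  then obtain j k where jk: "i * j = m * k + 1"
    using bezout_nat[of i m] i by auto
  have iter: "x ^ 2 ^ (n * j) = x" if "x ^ 2 ^ n = x" for n j
    by (induction j) (simp_all add: power_add power_mult that mult.commute)
  have "x = x ^ 2 ^ (m * k + 1)" using iter[OF i(3), of j] jk by simp
  also have "\<dots> = (x ^ 2 ^ (m * k))\<^sup>2"
    by (simp only: power_add power_one_right power_mult[of x "2 ^ (m * k)" 2])
  also have "\<dots> = x\<^sup>2" using iter[of m k] x by (simp add: F_def)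
  finally show ?thesis by (simp add: power2_eq_square)
qed

sublocale fused \<Omega> r "2 ^ m + 1" frob m
proof
  show "finite \<Omega>"
    using finite_F by (rule_tac finite_subset[of _ "F \<times> F"]) (auto simp: \<Omega>_def)
  show "r x y = r y x" for x y by (rule r_sym)
  show "r x y = r z z \<longleftrightarrow> x = y" if "x \<in> \<Omega>" "y \<in> \<Omega>" "z \<in> \<Omega>" for x y z
    using that r_eq_0_iff[of z z] r_eq_0_iff[of x y] by simp
  show "card {z \<in> \<Omega>. r x z = r y w} = 2 ^ m + 1" if "x \<in> \<Omega>" "y \<in> \<Omega>" "w \<in> \<Omega>" "y \<noteq> w" for x y w
    using that r_in_T r_eq_0_iff by (intro card_relation) auto
  show "0 < m" by (rule m_pos)
  show "frob x \<in> \<Omega>" if "x \<in> \<Omega>" for x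
    using that power2_in_T_iff by (auto simp: \<Omega>_def frob_def F_closed simp flip: power_mult_distrib)
  show "(frob ^^ m) x = x" if x: "x \<in> \<Omega>" for x
  proof -
    obtain a c where "x = (a, c)" "a \<in> F" "c \<in> F" using x by (auto simp: \<Omega>_def)
    then show ?thesis by (simp add: frob_power F_def)
  qed
  show "r (frob x) (frob y) = r (frob x') (frob y')" if "r x y = r x' y'" for x y x' y'
    by (simp add: r_frob that)
  show "r ((frob ^^ i) x) ((frob ^^ i) y) \<noteq> r x y"
    if "x \<in> \<Omega>" "y \<in> \<Omega>" "x \<noteq> y" "0 < i" "i < m" for x y i
    using fixed_by_Frobenius_power[of "r x y" i] that r_in_T[of x y] r_eq_0_iff[of x y] one_notin_T T_subset
    by (auto simp: r_frob_power)
  show "Suc (card {z \<in> \<Omega>. r x z = r y z}) = 2 ^ m + 1" if "x \<in> \<Omega>" "y \<in> \<Omega>" "x \<noteq> y" for x y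
    using card_equal_relation that by simp
qed (rule r_transitive)

end

section \<open>Finite fields of characteristic two\<close>

text \<open>A repeated linear factor would give a common root with the derivative, so the multiset
  of roots has no repetitions.\<close>

lemma card_roots_of_separable:
  fixes p :: "'a::alg_closed_field poly"
  assumes p: "p \<noteq> 0" and sep: "\<And>x. poly p x = 0 \<Longrightarrow> poly (pderiv p) x \<noteq> 0"
  shows "card {x. poly p x = 0} = degree p"
proof -
  obtain l A where A: "size A = degree p" "p = smult l (\<Prod>x\<in>#A. [:-x, 1:])"
    using alg_closed_imp_factorization[OF p] by blast
  have "poly p x = l * (\<Prod>a\<in>#A. x - a)" for x
    by (subst A(2)) (simp add: poly_prod_mset image_mset.compositionality o_def)
  moreover have "l \<noteq> 0" using A(2) p by auto
  ultimately have roots: "{x. poly p x = 0} = set_mset A"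
    by (auto simp: prod_mset_zero_iff)
  have "count A x = 1" if x: "x \<in># A" for x
  proof (rule ccontr)
    assume "count A x \<noteq> 1"
    moreover obtain B where B: "A = add_mset x B" using x by (metis mset_add)
    ultimately have "count B x \<noteq> 0" by simp
    then have "x \<in># B" by (metis not_in_iff)
    then obtain C where "B = add_mset x C" by (metis mset_add)
    then have "p = [:-x, 1:] * ([:-x, 1:] * smult l (\<Prod>x\<in>#C. [:-x, 1:]))"
      using A(2) B by simp
    then obtain R where R: "p = [:-x, 1:] * ([:-x, 1:] * R)" by blast
    have "poly p x = 0" "poly (pderiv p) x = 0"
      unfolding R by (simp_all add: pderiv_mult del: mult_pCons_left)
    then show False using sep by blast
  qed
  then have "size A = card (set_mset A)"
    by (simp add: size_multiset_overloaded_eq)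
  then show ?thesis using A roots by simp
qed

lemma bit_alg_closure_char2: "(1 :: bit alg_closure) + 1 = 0"
proof -
  have "(1 :: bit alg_closure) + 1 = to_ac (1 + 1)" by (simp only: to_ac_add to_ac_1)
  then show ?thesis by simp
qed

text \<open>The elements are the roots of \<open>X ^ 2 ^ m - X\<close>, which is separable because
  its derivative is \<open>- 1\<close>.\<close>

lemma card_bit_alg_closure_subfield:
  assumes "0 < m"
  shows "card {x :: bit alg_closure. x ^ 2 ^ m = x} = 2 ^ m"
proof -
  define p :: "bit alg_closure poly" where "p = monom 1 (2 ^ m) - [:0, 1:]"
  have "(2 :: bit alg_closure) = 0"
    using bit_alg_closure_char2 by simp
  then have "of_nat (2 ^ m) = (0 :: bit alg_closure)"
    using assms by simp
  then have "pderiv p = - 1"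
    by (simp add: p_def pderiv_diff pderiv_monom pderiv_pCons one_pCons del: of_nat_power)
  moreover have "(2::nat) ^ m > 1"
    using assms by (intro one_less_power) auto
  then have deg: "degree p = 2 ^ m"
    unfolding p_def diff_conv_add_uminus by (subst degree_add_eq_left) (simp_all add: degree_monom_eq)
  moreover from this have "p \<noteq> 0" by auto
  ultimately have "card {x. poly p x = 0} = 2 ^ m"
    using card_roots_of_separable[of p] by simp
  then show ?thesis by (simp add: p_def poly_monom)
qed

text \<open>Yields the bound \<open>t \<le> n + 1\<close> required for Latin square type.\<close>

lemma two_m_plus_2_le_power: "3 \<le> m \<Longrightarrow> 2 * int m + 2 \<le> 2 ^ m"
proof (induction m rule: dec_induct)
  case (step m)
  have "(2::int) \<le> 2 ^ m" using step.hyps by (intro self_le_power) auto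
  then show ?case using step.IH by simp
qed simp

section \<open>The strongly regular graph\<close>

theorem theorem9:
  fixes m :: nat and q v k l \<mu> :: int
  assumes "prime m" and "odd m"
    and "q = 2 ^ m"
    and "v = (q\<^sup>2 * (q - 1)\<^sup>2) div 4"
    and "k = int m * (q + 1) * ((q * (q - 1)) div 2 - 1)"
    and "l = (q * (q - 1)) div 2 + (int m)\<^sup>2 * (q + 1)\<^sup>2 - 3 * int m * (q + 1)"
    and "\<mu> = (int m)\<^sup>2 * (q + 1)\<^sup>2 - int m * (q + 1)"
  shows "\<exists>G :: nat pair_pre_digraph. strongly_regular G v k l \<mu> \<and> latin_square_type v k l \<mu>"
proof -
  have m: "3 \<le> m"
    using prime_ge_2_nat[OF assms(1)] assms(2) by (cases "m = 2") auto
  then have "0 < m" by simp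
  interpret binary_field "{x :: bit alg_closure. x ^ 2 ^ m = x}" m
    by standard
      (use assms(1,2) bit_alg_closure_char2 card_bit_alg_closure_subfield[OF \<open>0 < m\<close>] in auto)
  interpret P: pseudocyclic \<Omega> c "m * (2 ^ m + 1)"
    by (rule pseudocyclic_fused)
  define n t where "n = int (card \<Omega>)" and "t = int m * (q + 1)"
  have "2 * n = int (2 * card \<Omega>)" by (simp add: n_def)
  also have "\<dots> = q * (q - 1)"
    by (simp add: card_points of_nat_diff assms(3))
  finally have n: "2 * n = q * (q - 1)" .
  \<comment> \<open>Shows that the division by 4 in \<open>v\<close> is exact.\<close>
  then have sq: "(2 * n)\<^sup>2 = q\<^sup>2 * (q - 1)\<^sup>2"
    by (simp only: power_mult_distrib)
  have "v = n\<^sup>2" using assms(4) unfolding sq[symmetric] by (simp add: power_mult_distrib)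
  moreover have "q * (q - 1) div 2 = n" using n by simp
  moreover have "(int m)\<^sup>2 * (q + 1)\<^sup>2 = t\<^sup>2"
    by (simp add: t_def power_mult_distrib)
  ultimately have params: "v = n\<^sup>2" "k = t * (n - 1)" "l = n + t\<^sup>2 - 3 * t" "\<mu> = t\<^sup>2 - t"
    using assms(5-7) by (simp_all add: t_def)
  have q: "2 * int m + 2 \<le> q"
    using two_m_plus_2_le_power[OF m] assms(3) by simp
  \<comment> \<open>The left side is \<open>2 * t\<close> and the right side is
    \<open>2 * n - 2\<close>.\<close>
  have "2 * int m * (q + 1) \<le> (q - 2) * (q + 1)"
    using q by (intro mult_right_mono) auto
  then have "t \<le> n + 1"
    using n by (simp add: t_def algebra_simps)
  moreover have "1 \<le> t"
    using q m mult_mono[of 1 "int m" 1 "q + 1"] by (simp add: t_def)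
  ultimately have "latin_square_type v k l \<mu>"
    unfolding latin_square_type_def params by blast
  moreover have "int (m * (2 ^ m + 1)) = t"
    by (simp add: t_def assms(3) algebra_simps)
  then have "\<exists>G :: nat pair_pre_digraph. strongly_regular G v k l \<mu>"
    using P.strongly_regular_latin_square_type unfolding params n_def by simp
  ultimately show ?thesis by blast
qed

end
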